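(* Let $\alpha\in(1,2)$, let $a:\mathbb{R}\to(0,\infty)$ be continuous with $\int_{\mathbb{R}}a(x)^{-1}\mathrm{d}x=1$, and let $\mu(\mathrm{d}x)=a(x)^{-1}\mathrm{d}x$. Let $(\mathscr{E},\mathscr{F})$ be the Dirichlet form of the time-changed symmetric $\alpha$-stable process $Y$ with generator $a(x)\Delta^{\alpha/2}$. Then the logarithmic Sobolev inequality holds, i.e. there is a constant $C>0$ such that $$\mathrm{Ent}(f^2)\leqslant\frac{2}{C}\mathscr{E}(f,f)\quad\text{for all }f\in\mathscr{F},$$ if and only if $$\sup_{x\in\mathbb{R}}\left\{|x|^{\alpha-1}\mu\big((-|x|,|x|)^c\big)\log\frac{1}{\mu((-|x|,|x|)^c)}\right\}<\infty.$$
   Context: The Dirichlet form of $Y$ is $$\mathscr{E}(f,g)=\frac12\int_{\mathbb{R}}\int_{\mathbb{R}}(f(x)-f(y))(g(x)-g(y))\frac{C_\alpha\,\mathrm{d}x\,\mathrm{d}y}{|x-y|^{1+\alpha}},\qquad \mathscr{F}=\{f\in L^2(\mu):\mathscr{E}(f,f)<\infty\},$$ with $C_\alpha=\frac{\alpha2^{\alpha-1}\Gamma((\alpha+1)/2)}{\pi^{1/2}\Gamma(1-\alpha/2)}$. For $f\ge0$, $\mathrm{Ent}(f)=\int_{\mathbb{R}}f\log f\,\mathrm{d}\mu-\mu(f)\log\mu(f)$, where $\mu(f)=\int f\,\mathrm{d}\mu$ and $0\log0=0$. $A^c=\mathbb{R}\setminus A$. *)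

theory Defs
  imports "HOL-Analysis.Analysis"
begin

text \<open>
  The Bochner integral returns 0 on non-integrable functions. Entropies and energies may be
  infinite, so they are defined through the extended integral, positive part minus negative
  part. In \<^typ>\<open>ereal\<close> we have \<open>\<infinity> - \<infinity> = \<infinity>\<close>; that case is meaningless here and does not occur for
  the entropy of an integrable function w.r.t. a probability measure, nor for \<open>\<E>(f, f)\<close>.
\<close>

definition ext_integral :: "'a measure \<Rightarrow> ('a \<Rightarrow> real) \<Rightarrow> ereal" where
  "ext_integral M h =
     enn2ereal (\<integral>\<^sup>+ x. ennreal (h x) \<partial>M) - enn2ereal (\<integral>\<^sup>+ x. ennreal (- h x) \<partial>M)"

lemma ext_integral_eq_integral:
  assumes "integrable M h"
  shows "ext_integral M h = ereal (integral\<^sup>L M h)"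
proof -
  have p: "(\<integral>\<^sup>+ x. ennreal (h x) \<partial>M) < \<infinity>" "(\<integral>\<^sup>+ x. ennreal (- h x) \<partial>M) < \<infinity>"
    using assms by (auto simp: real_integrable_def less_top)
  then show ?thesis
    unfolding ext_integral_def real_lebesgue_integral_def[OF assms]
    by (cases "\<integral>\<^sup>+ x. ennreal (h x) \<partial>M"; cases "\<integral>\<^sup>+ x. ennreal (- h x) \<partial>M")
       (auto simp: enn2ereal_ennreal)
qed

lemma ext_integral_nonneg:
  assumes "\<And>x. h x \<ge> 0"
  shows "ext_integral M h = enn2ereal (\<integral>\<^sup>+ x. ennreal (h x) \<partial>M)"
  using assms by (simp add: ext_integral_def ennreal_neg zero_ennreal.rep_eq)

definition stable_const :: "real \<Rightarrow> real" where
  "stable_const \<alpha> =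
     \<alpha> * 2 powr (\<alpha> - 1) * Gamma ((\<alpha> + 1) / 2) / (pi powr (1 / 2) * Gamma (1 - \<alpha> / 2))"

definition speed_measure :: "(real \<Rightarrow> real) \<Rightarrow> real measure" where
  "speed_measure a = density lborel (\<lambda>x. ennreal (1 / a x))"

text \<open>
  Division by zero on the diagonal is harmless: the diagonal is a null set and the numerator
  vanishes there.
\<close>

definition stable_form :: "real \<Rightarrow> (real \<Rightarrow> real) \<Rightarrow> (real \<Rightarrow> real) \<Rightarrow> ereal" where
  "stable_form \<alpha> f g =
     ereal (1 / 2) * ext_integral (lborel \<Otimes>\<^sub>M lborel)
       (\<lambda>(x, y). (f x - f y) * (g x - g y) * stable_const \<alpha> / \<bar>x - y\<bar> powr (1 + \<alpha>))"

definition stable_form_domain :: "real \<Rightarrow> real measure \<Rightarrow> (real \<Rightarrow> real) set" where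
  "stable_form_domain \<alpha> M =
     {f \<in> borel_measurable M. integrable M (\<lambda>x. (f x)\<^sup>2) \<and> stable_form \<alpha> f f < \<infinity>}"

text \<open>
  Meant for nonnegative \<open>f\<close> with \<open>\<mu>(f) < \<infinity>\<close>. Since \<^prop>\<open>ln (0::real) = 0\<close>, the convention
  \<open>0 log 0 = 0\<close> is built in.
\<close>

definition Ent :: "'a measure \<Rightarrow> ('a \<Rightarrow> real) \<Rightarrow> ereal" where
  "Ent M f = ext_integral M (\<lambda>x. f x * ln (f x))
     - ereal (integral\<^sup>L M f * ln (integral\<^sup>L M f))"

end

theory Submission
  imports Defs "HOL-Probability.Probability_Measure"
begin

text \<open>
  For \<open>\<alpha> > 1\<close> a function of finite energy satisfies
  \<open>(f(x) - f(y))\<^sup>2 \<le> M |x - y|\<^bsup>\<alpha>-1\<^esup> \<E>(f, f)\<close> (telescoping of dyadic averages).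

  Sufficiency: fix a good point \<open>x\<^sub>0\<close> near 0, put \<open>g = f - f(x\<^sub>0)\<close> and cut \<open>|g|\<close> into dyadic layers
  \<open>g\<^sub>k\<close> between the heights \<open>u\<^sub>k\<close> and \<open>2u\<^sub>k\<close>. Each layer vanishes at \<open>x\<^sub>0\<close> and equals \<open>u\<^sub>k\<close> on
  \<open>A\<^sub>k = {|g| > 2u\<^sub>k}\<close>, so \<open>A\<^sub>k\<close> lies at a distance \<open>\<rho>\<close> from \<open>x\<^sub>0\<close> with
  \<open>u\<^sub>k\<^sup>2 \<le> M \<rho>\<^bsup>\<alpha>-1\<^esup> \<E>(g\<^sub>k, g\<^sub>k)\<close>. The tail condition turns this into
  \<open>u\<^sub>k\<^sup>2 \<mu>(A\<^sub>k) log (18 / \<mu>(A\<^sub>k)) \<le> const \<cdot> \<E>(g\<^sub>k, g\<^sub>k)\<close>. The layer energies add up to at most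
  \<open>\<E>(f, f)\<close>, while the left-hand sides add up to a bound of \<open>Ent(f\<^sup>2)\<close>.

  Necessity: test with a ramp that vanishes on \<open>[-r/2, r/2]\<close> and is 1 outside \<open>(-r, r)\<close>; its energy
  is at most of order \<open>r\<^bsup>1-\<alpha>\<^esup>\<close> by scaling, and the variational formula bounds its entropy from below.
\<close>

subsection \<open>Energy and the Morrey inequality\<close>

text \<open>Inner integral of the form, without its constant. Finiteness at \<open>x\<close> is what
  makes the single value \<open>f x\<close> meaningful below.\<close>

definition local_energy :: "real \<Rightarrow> (real \<Rightarrow> real) \<Rightarrow> real \<Rightarrow> ennreal" where
  "local_energy \<alpha> f x = (\<integral>\<^sup>+ y. ennreal ((f x - f y)\<^sup>2 / \<bar>x - y\<bar> powr (1 + \<alpha>)) \<partial>lborel)"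

definition energy :: "real \<Rightarrow> (real \<Rightarrow> real) \<Rightarrow> ennreal" where
  "energy \<alpha> f = (\<integral>\<^sup>+ x. local_energy \<alpha> f x \<partial>lborel)"

lemma measurable_local_energy [measurable]:
  assumes [measurable]: "f \<in> borel_measurable borel"
  shows "local_energy \<alpha> f \<in> borel_measurable borel"
  unfolding local_energy_def[abs_def] by measurable

lemma stable_const_pos:
  assumes "0 < \<alpha>" "\<alpha> < 2"
  shows "stable_const \<alpha> > 0"
  unfolding stable_const_def using assms
  by (intro divide_pos_pos mult_pos_pos Gamma_real_pos) auto

text \<open>For equal arguments the integrand is nonnegative, so no negative part is subtracted and
  Tonelli gives the iterated integral.\<close>

lemma stable_form_eq_energy:
  assumes "0 < \<alpha>" "\<alpha> < 2" and [measurable]: "f \<in> borel_measurable borel"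
  shows "stable_form \<alpha> f f = ereal (stable_const \<alpha> / 2) * enn2ereal (energy \<alpha> f)"
proof -
  let ?c = "stable_const \<alpha>"
  have c: "?c > 0" by (rule stable_const_pos) fact+
  have "ext_integral (lborel \<Otimes>\<^sub>M lborel)
       (\<lambda>(x, y). (f x - f y) * (f x - f y) * ?c / \<bar>x - y\<bar> powr (1 + \<alpha>)) =
     enn2ereal (\<integral>\<^sup>+ z. ennreal ((\<lambda>(x, y). (f x - f y) * (f x - f y) * ?c / \<bar>x - y\<bar> powr (1 + \<alpha>)) z)
        \<partial>(lborel \<Otimes>\<^sub>M lborel))"
    using c by (intro ext_integral_nonneg) (auto simp: power2_eq_square[symmetric])
  also have "(\<integral>\<^sup>+ z. ennreal ((\<lambda>(x, y). (f x - f y) * (f x - f y) * ?c / \<bar>x - y\<bar> powr (1 + \<alpha>)) z)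
        \<partial>(lborel \<Otimes>\<^sub>M lborel)) =
      (\<integral>\<^sup>+ z. ennreal ?c * (\<lambda>(x, y). ennreal ((f x - f y)\<^sup>2 / \<bar>x - y\<bar> powr (1 + \<alpha>))) z
        \<partial>(lborel \<Otimes>\<^sub>M lborel))"
    using c by (intro nn_integral_cong)
      (auto simp: ennreal_mult'[symmetric] power2_eq_square mult_ac)
  also have "\<dots> = ennreal ?c * (\<integral>\<^sup>+ z. (\<lambda>(x, y). ennreal ((f x - f y)\<^sup>2 / \<bar>x - y\<bar> powr (1 + \<alpha>))) z
        \<partial>(lborel \<Otimes>\<^sub>M lborel))"
    by (rule nn_integral_cmult) measurable
  also have "(\<integral>\<^sup>+ z. (\<lambda>(x, y). ennreal ((f x - f y)\<^sup>2 / \<bar>x - y\<bar> powr (1 + \<alpha>))) z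
        \<partial>(lborel \<Otimes>\<^sub>M lborel)) = energy \<alpha> f"
    unfolding energy_def local_energy_def
    by (subst lborel.nn_integral_fst[symmetric]) auto
  finally show ?thesis
    using c unfolding stable_form_def
    by (simp add: times_ennreal.rep_eq enn2ereal_ennreal mult.assoc[symmetric])
qed

text \<open>Jensen's inequality for the square, via the tangent line at the mean \<open>m\<close>;
  the gap is \<open>(f x - m)^2\<close>. The right-hand side may be infinite.\<close>

lemma (in prob_space) square_expectation_diff_le:
  assumes f: "integrable M f"
  shows "ennreal ((integral\<^sup>L M f - c)\<^sup>2) \<le> (\<integral>\<^sup>+ x. ennreal ((f x - c)\<^sup>2) \<partial>M)"
proof (cases "(\<integral>\<^sup>+ x. ennreal ((f x - c)\<^sup>2) \<partial>M) = \<infinity>")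
  case False
  have [measurable]: "f \<in> borel_measurable M" using f by auto
  have i: "integrable M (\<lambda>x. (f x - c)\<^sup>2)"
    using False by (intro integrableI_nonneg) (auto simp: less_top)
  define m where "m = integral\<^sup>L M f"
  have "(m - c)\<^sup>2 = (\<integral>x. (m - c)\<^sup>2 + 2 * (m - c) * (f x - m) \<partial>M)"
    using f by (simp add: m_def prob_space)
  also have "\<dots> \<le> (\<integral>x. (f x - c)\<^sup>2 \<partial>M)"
  proof (rule integral_mono)
    fix x
    have "0 \<le> (f x - m)\<^sup>2" by simp
    then show "(m - c)\<^sup>2 + 2 * (m - c) * (f x - m) \<le> (f x - c)\<^sup>2"
      by (simp add: power2_eq_square algebra_simps)
  qed (use f i in auto)
  finally show ?thesis
    unfolding m_def[symmetric] using i by (subst nn_integral_eq_integral) (auto intro: ennreal_leI)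
qed auto

section \<open>Interval averages\<close>

abbreviation unif :: "real \<Rightarrow> real \<Rightarrow> real measure" where
  "unif p q \<equiv> uniform_measure lborel {p..q}"

lemma prob_space_unif: "p < q \<Longrightarrow> prob_space (unif p q)"
  by (rule prob_space_uniform_measure) auto

lemma integrable_unif:
  fixes f :: "real \<Rightarrow> real"
  assumes "p < q" "f \<in> borel_measurable borel" "\<And>x. \<bar>f x\<bar> \<le> B"
  shows "integrable (unif p q) f"
proof -
  interpret prob_space "unif p q" using assms(1) by (rule prob_space_unif)
  show ?thesis by (rule integrable_const_bound[where B = B]) (use assms in auto)
qed

text \<open>Jensen in \<open>y\<close>; then the kernel is at least
  \<open>1 / d powr (1 + \<alpha>)\<close> on \<open>{p..q}\<close> off \<open>y = x\<close>, while
  at \<open>y = x\<close> the numerator vanishes.\<close>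

lemma square_average_diff_le_local_energy:
  assumes "0 < \<alpha>" "p < q" and [measurable]: "f \<in> borel_measurable borel"
    and "\<And>x. \<bar>f x\<bar> \<le> B" and d: "\<And>y. y \<in> {p..q} \<Longrightarrow> \<bar>x - y\<bar> \<le> d"
  shows "ennreal ((integral\<^sup>L (unif p q) f - f x)\<^sup>2)
    \<le> ennreal (d powr (1 + \<alpha>) / (q - p)) * local_energy \<alpha> f x"
proof -
  interpret prob_space "unif p q" using assms(2) by (rule prob_space_unif)
  have "ennreal ((integral\<^sup>L (unif p q) f - f x)\<^sup>2) \<le> (\<integral>\<^sup>+ y. ennreal ((f y - f x)\<^sup>2) \<partial>unif p q)"
    by (intro square_expectation_diff_le integrable_unif[where B = B] assms)
  also have "\<dots> = (\<integral>\<^sup>+ y. ennreal ((f y - f x)\<^sup>2) * indicator {p..q} y \<partial>lborel) / ennreal (q - p)"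
    using assms(2) by (subst nn_integral_uniform_measure) auto
  also have "(\<integral>\<^sup>+ y. ennreal ((f y - f x)\<^sup>2) * indicator {p..q} y \<partial>lborel)
    \<le> (\<integral>\<^sup>+ y. ennreal (d powr (1 + \<alpha>)) * ennreal ((f x - f y)\<^sup>2 / \<bar>x - y\<bar> powr (1 + \<alpha>)) \<partial>lborel)"
  proof (rule nn_integral_mono)
    fix y
    have "(f y - f x)\<^sup>2 \<le> d powr (1 + \<alpha>) * ((f x - f y)\<^sup>2 / \<bar>x - y\<bar> powr (1 + \<alpha>))" if "y \<in> {p..q}"
    proof (cases "x = y")
      case False
      then have "\<bar>x - y\<bar> powr (1 + \<alpha>) \<le> d powr (1 + \<alpha>)" "\<bar>x - y\<bar> powr (1 + \<alpha>) > 0"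
        using d[OF that] assms(1) by (auto intro!: powr_mono2)
      then show ?thesis
        by (auto simp: field_simps power2_commute[of "f x"] intro!: mult_right_mono)
    qed auto
    then show "ennreal ((f y - f x)\<^sup>2) * indicator {p..q} y
       \<le> ennreal (d powr (1 + \<alpha>)) * ennreal ((f x - f y)\<^sup>2 / \<bar>x - y\<bar> powr (1 + \<alpha>))"
      by (auto simp: ennreal_mult'[symmetric] split: split_indicator intro!: ennreal_leI)
  qed
  also have "\<dots> = ennreal (d powr (1 + \<alpha>)) * local_energy \<alpha> f x"
    unfolding local_energy_def by (rule nn_integral_cmult) measurable
  also have "\<dots> / ennreal (q - p) = ennreal (d powr (1 + \<alpha>) / (q - p)) * local_energy \<alpha> f x"
    using assms(2) by (simp add: divide_ennreal[symmetric] ennreal_times_divide mult.commute)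
  finally show ?thesis by (simp add: divide_right_mono_ennreal)
qed

text \<open>Jensen in \<open>x\<close>, after which the pointwise bound by
  \<open>local_energy\<close> is integrated in \<open>x\<close>.\<close>

lemma square_average_diff_le_energy:
  assumes "0 < \<alpha>" "p < q" "s < t" and [measurable]: "f \<in> borel_measurable borel"
    and "\<And>x. \<bar>f x\<bar> \<le> B"
    and d: "\<And>x y. x \<in> {p..q} \<Longrightarrow> y \<in> {s..t} \<Longrightarrow> \<bar>x - y\<bar> \<le> d"
  shows "ennreal ((integral\<^sup>L (unif p q) f - integral\<^sup>L (unif s t) f)\<^sup>2)
    \<le> ennreal (d powr (1 + \<alpha>) / ((q - p) * (t - s))) * energy \<alpha> f"
proof -
  interpret prob_space "unif p q" using assms(2) by (rule prob_space_unif)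
  define b where "b = integral\<^sup>L (unif s t) f"
  have "ennreal ((integral\<^sup>L (unif p q) f - b)\<^sup>2) \<le> (\<integral>\<^sup>+ x. ennreal ((f x - b)\<^sup>2) \<partial>unif p q)"
    by (intro square_expectation_diff_le integrable_unif[where B = B] assms)
  also have "\<dots> = (\<integral>\<^sup>+ x. ennreal ((f x - b)\<^sup>2) * indicator {p..q} x \<partial>lborel) / ennreal (q - p)"
    using assms(2) by (subst nn_integral_uniform_measure) auto
  also have "(\<integral>\<^sup>+ x. ennreal ((f x - b)\<^sup>2) * indicator {p..q} x \<partial>lborel)
    \<le> (\<integral>\<^sup>+ x. ennreal (d powr (1 + \<alpha>) / (t - s)) * local_energy \<alpha> f x \<partial>lborel)"
    using square_average_diff_le_local_energy[OF assms(1,3,4,5) d]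
    by (intro nn_integral_mono) (auto simp: b_def power2_commute split: split_indicator)
  also have "\<dots> = ennreal (d powr (1 + \<alpha>) / (t - s)) * energy \<alpha> f"
    unfolding energy_def by (rule nn_integral_cmult) measurable
  also have "\<dots> / ennreal (q - p) = ennreal (d powr (1 + \<alpha>) / ((q - p) * (t - s))) * energy \<alpha> f"
  proof -
    have "ennreal (d powr (1 + \<alpha>) / ((q - p) * (t - s))) = ennreal (d powr (1 + \<alpha>) / (t - s)) / ennreal (q - p)"
      using assms(2,3) by (subst divide_ennreal) (auto simp: field_simps)
    then show ?thesis by (simp add: ennreal_times_divide mult.commute)
  qed
  finally show ?thesis by (simp add: divide_right_mono_ennreal b_def)
qed

lemma abs_le_sqrt_mult_enn2real:
  assumes "ennreal (z\<^sup>2) \<le> ennreal k * E" "E < \<infinity>" "0 \<le> k"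
  shows "\<bar>z\<bar> \<le> sqrt (k * enn2real E)"
proof -
  have "E = ennreal (enn2real E)"
    using assms(2) by simp
  then have "ennreal (z\<^sup>2) \<le> ennreal (k * enn2real E)"
    using assms(1,3) by (metis enn2real_nonneg ennreal_mult)
  then have "z\<^sup>2 \<le> k * enn2real E"
    using assms(3) by (subst (asm) ennreal_le_iff) auto
  then show ?thesis
    using real_le_rsqrt by (metis power2_abs)
qed

text \<open>The averages over the halving intervals telescope: their increments are controlled
  geometrically by the energy, while the local energy at \<open>z\<close> serves to identify the
  limit as \<open>f z\<close>.\<close>

lemma average_minus_value_le:
  fixes p q :: "nat \<Rightarrow> real"
  assumes \<alpha>: "1 < \<alpha>" and f[measurable]: "f \<in> borel_measurable borel" and B: "\<And>x. \<bar>f x\<bar> \<le> B"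
    and d: "0 < d" and len: "\<And>n. q n - p n = d / 2 ^ n"
    and nest: "\<And>n. p n \<le> p (Suc n)" "\<And>n. q (Suc n) \<le> q n"
    and z: "\<And>n. z \<in> {p n..q n}"
    and fin: "local_energy \<alpha> f z < \<infinity>" "energy \<alpha> f < \<infinity>"
  shows "\<bar>integral\<^sup>L (unif (p 0) (q 0)) f - f z\<bar>
    \<le> sqrt (2 * d powr (\<alpha> - 1) * enn2real (energy \<alpha> f)) / (1 - 2 powr (- (\<alpha> - 1) / 2))"
proof -
  define m where "m n = integral\<^sup>L (unif (p n) (q n)) f" for n
  define l where "l = 2 powr (- (\<alpha> - 1) / 2)"
  define S where "S = sqrt (2 * d powr (\<alpha> - 1) * enn2real (energy \<alpha> f))"
  have l: "0 < l" "l < 1" using \<alpha> by (auto simp: l_def powr_less_one)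
  have pq: "p n < q n" for n using len[of n] d by (smt (verit) divide_pos_pos zero_less_power)
  have dn: "0 < d / 2 ^ n" for n using d by simp
  \<comment> \<open>Consecutive intervals lie within distance \<open>d / 2 ^ n\<close> and have
    lengths \<open>d / 2 ^ n\<close> and half of it, whence the factor 2 and the exponent
    \<open>\<alpha> - 1\<close>. As this is positive, the bound decays, with
    \<open>l^2 = 2 powr (- (\<alpha> - 1))\<close>.\<close>
  have step: "\<bar>m n - m (Suc n)\<bar> \<le> S * l ^ n" for n
  proof -
    let ?d = "d / 2 ^ n"
    have "ennreal ((m n - m (Suc n))\<^sup>2)
      \<le> ennreal (?d powr (1 + \<alpha>) / ((q n - p n) * (q (Suc n) - p (Suc n)))) * energy \<alpha> f"
      unfolding m_def using nest[of n] \<alpha> pq len[of n]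
      by (intro square_average_diff_le_energy[OF _ _ _ f B]) auto
    also have "?d powr (1 + \<alpha>) / ((q n - p n) * (q (Suc n) - p (Suc n))) = 2 * ?d powr (\<alpha> - 1)"
    proof -
      have "?d powr (1 + \<alpha>) = ?d powr (\<alpha> - 1) * ?d\<^sup>2"
        using dn[of n] powr_add[of ?d "\<alpha> - 1" 2] by simp
      moreover have "q (Suc n) - p (Suc n) = ?d / 2" using len[of "Suc n"] by simp
      ultimately show ?thesis using len[of n] dn[of n] by (simp add: power2_eq_square)
    qed
    finally have "\<bar>m n - m (Suc n)\<bar> \<le> sqrt (2 * ?d powr (\<alpha> - 1) * enn2real (energy \<alpha> f))"
      using fin by (intro abs_le_sqrt_mult_enn2real) auto
    also have "?d powr (\<alpha> - 1) = d powr (\<alpha> - 1) * (l ^ n)\<^sup>2"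
    proof -
      have "(l ^ n)\<^sup>2 = l powr (real n * 2)"
        using l by (simp add: powr_realpow[symmetric] powr_powr)
      also have "\<dots> = 2 powr (- real n * (\<alpha> - 1))"
        by (simp add: l_def powr_powr) (simp add: algebra_simps)
      also have "\<dots> = (1 / 2 ^ n) powr (\<alpha> - 1)"
        by (simp add: powr_divide powr_minus_divide powr_powr flip: powr_realpow)
      finally show ?thesis using d by (simp add: powr_divide)
    qed
    also have "sqrt (2 * (d powr (\<alpha> - 1) * (l ^ n)\<^sup>2) * enn2real (energy \<alpha> f)) = S * l ^ n"
      using l by (simp add: S_def real_sqrt_mult)
    finally show ?thesis .
  qed
  have S0: "0 \<le> S" by (simp add: S_def)
  have sum: "\<bar>m 0 - m n\<bar> \<le> S * (\<Sum>k<n. l ^ k)" for n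
  proof (induction n)
    case (Suc n)
    then show ?case using step[of n] by (simp add: distrib_left)
  qed simp
  have bound: "\<bar>m 0 - m n\<bar> \<le> S / (1 - l)" for n
  proof -
    have "(\<Sum>k<n. l ^ k) = (1 - l ^ n) / (1 - l)"
      using l sum_gp_strict[of l n] by simp
    also have "\<dots> \<le> 1 / (1 - l)" using l by (intro divide_right_mono) auto
    finally have "S * (\<Sum>k<n. l ^ k) \<le> S * (1 / (1 - l))" using S0 by (rule mult_left_mono)
    then show ?thesis using sum[of n] by simp
  qed
  \<comment> \<open>Only one of the two points is averaged here, which leaves the exponent
    \<open>\<alpha>\<close>; the bound tends to 0.\<close>
  have conv: "\<bar>m n - f z\<bar> \<le> sqrt ((d / 2 ^ n) powr \<alpha> * enn2real (local_energy \<alpha> f z))" for n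
  proof -
    let ?d = "d / 2 ^ n"
    have "ennreal ((m n - f z)\<^sup>2) \<le> ennreal (?d powr (1 + \<alpha>) / (q n - p n)) * local_energy \<alpha> f z"
      unfolding m_def using z[of n] \<alpha> pq len[of n]
      by (intro square_average_diff_le_local_energy[OF _ _ f B]) auto
    also have "?d powr (1 + \<alpha>) / (q n - p n) = ?d powr \<alpha>"
      using d len[of n] by (simp add: powr_add)
    finally show ?thesis
      using fin by (intro abs_le_sqrt_mult_enn2real) auto
  qed
  have lim: "(\<lambda>n. sqrt ((d / 2 ^ n) powr \<alpha> * enn2real (local_energy \<alpha> f z)))
      \<longlonglongrightarrow> sqrt (0 powr \<alpha> * enn2real (local_energy \<alpha> f z))"
  proof -
    have "(\<lambda>n. d / 2 ^ n) \<longlonglongrightarrow> 0"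
      by (rule LIMSEQ_divide_realpow_zero) simp
    then show ?thesis using \<alpha> d by (intro tendsto_intros) auto
  qed
  have "(\<lambda>n. m n - f z) \<longlonglongrightarrow> 0"
    by (rule Lim_null_comparison[OF _ lim[simplified]]) (use conv in auto)
  then have "m \<longlonglongrightarrow> f z" by (simp add: LIM_zero_iff)
  then have "(\<lambda>n. \<bar>m 0 - m n\<bar>) \<longlonglongrightarrow> \<bar>m 0 - f z\<bar>" by (intro tendsto_intros)
  then have "\<bar>m 0 - f z\<bar> \<le> S / (1 - l)"
    by (rule LIMSEQ_le_const2) (use bound in auto)
  then show ?thesis by (simp add: m_def S_def l_def)
qed

text \<open>One use of \<open>average_minus_value_le\<close> per endpoint gives a factor 2, hence 4
  after squaring, times the 2 under the square root.\<close>

definition morrey_const :: "real \<Rightarrow> real" where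
  "morrey_const \<alpha> = 8 / (1 - 2 powr (- (\<alpha> - 1) / 2))\<^sup>2"

lemma morrey_const_pos:
  assumes "1 < \<alpha>"
  shows "morrey_const \<alpha> > 0"
proof -
  have "2 powr (- (\<alpha> - 1) / 2) < 1" using assms by (intro powr_less_one) auto
  then show ?thesis using assms by (simp add: morrey_const_def)
qed

text \<open>
  Points of finite local energy are Lebesgue points, so the Hoelder bound holds between them and no
  continuous version of \<open>f\<close> has to be constructed. A contraction of \<open>f\<close> inherits these points.
\<close>
lemma morrey:
  assumes \<alpha>: "1 < \<alpha>" and f: "f \<in> borel_measurable borel" and B: "\<And>x. \<bar>f x\<bar> \<le> B"
    and fin: "local_energy \<alpha> f x < \<infinity>" "local_energy \<alpha> f y < \<infinity>" "energy \<alpha> f < \<infinity>"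
  shows "(f x - f y)\<^sup>2 \<le> morrey_const \<alpha> * \<bar>x - y\<bar> powr (\<alpha> - 1) * enn2real (energy \<alpha> f)"
  using fin(1,2)
proof (induction x y rule: linorder_wlog)
  case (sym x y)
  then show ?case by (simp add: power2_commute abs_minus_commute)
next
  case (le x y)
  show ?case
  proof (cases "x = y")
    case False
    define d where "d = y - x"
    have d: "d > 0" using False le by (simp add: d_def)
    define b where "b = sqrt (2 * d powr (\<alpha> - 1) * enn2real (energy \<alpha> f))"
    define l where "l = 1 - 2 powr (- (\<alpha> - 1) / 2)"
    define m where "m = integral\<^sup>L (unif x y) f"
    have dn: "d / 2 ^ n \<ge> d / 2 ^ Suc n" "d / 2 ^ n \<ge> 0" for n using d by (auto simp: field_simps)
    \<comment> \<open>Intervals shrinking to the left end and, next, to the right end both start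
      from \<open>{x..y}\<close>, so the same average \<open>m\<close> serves both.\<close>
    have "\<bar>m - f x\<bar> \<le> b / l"
      using average_minus_value_le[OF \<alpha> f B d, of "\<lambda>n. x + d / 2 ^ n" "\<lambda>_. x" x] dn le fin
      by (simp add: b_def l_def m_def d_def)
    moreover have "\<bar>m - f y\<bar> \<le> b / l"
      using average_minus_value_le[OF \<alpha> f B d, of "\<lambda>_. y" "\<lambda>n. y - d / 2 ^ n" y] dn le fin
      by (simp add: b_def l_def m_def d_def)
    ultimately have "\<bar>f x - f y\<bar> \<le> 2 * b / l" by simp
    then have "(f x - f y)\<^sup>2 \<le> (2 * b / l)\<^sup>2" by (metis abs_ge_zero power2_abs power_mono)
    also have "(2 * b / l)\<^sup>2 = 4 * b\<^sup>2 / l\<^sup>2" by (simp add: power_divide)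
    also have "b\<^sup>2 = 2 * d powr (\<alpha> - 1) * enn2real (energy \<alpha> f)" by (simp add: b_def)
    also have "4 * \<dots> / l\<^sup>2 = morrey_const \<alpha> * \<bar>x - y\<bar> powr (\<alpha> - 1) * enn2real (energy \<alpha> f)"
      using d by (simp add: morrey_const_def l_def d_def abs_minus_commute)
    finally show ?thesis .
  qed simp
qed

section \<open>Contractions and dyadic layers\<close>

lemma energy_contraction:
  assumes "\<And>x y. \<bar>g x - g y\<bar> \<le> \<bar>f x - f y\<bar>"
  shows "local_energy \<alpha> g x \<le> local_energy \<alpha> f x" "energy \<alpha> g \<le> energy \<alpha> f"
proof -
  show *: "local_energy \<alpha> g x \<le> local_energy \<alpha> f x" for x
    unfolding local_energy_def
    by (intro nn_integral_mono ennreal_leI divide_right_mono abs_le_square_iff[THEN iffD1] assms) auto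
  show "energy \<alpha> g \<le> energy \<alpha> f"
    unfolding energy_def by (intro nn_integral_mono *)
qed

text \<open>The inequality between squared increments is integrated against the kernel. Bounds on
  partial sums suffice because the terms are nonnegative.\<close>

lemma suminf_energy_le:
  fixes g :: "nat \<Rightarrow> real \<Rightarrow> real"
  assumes [measurable]: "\<And>k. g k \<in> borel_measurable borel" "f \<in> borel_measurable borel"
    and le: "\<And>n x y. (\<Sum>k<n. (g k x - g k y)\<^sup>2) \<le> (f x - f y)\<^sup>2"
  shows "(\<Sum>k. energy \<alpha> (g k)) \<le> energy \<alpha> f"
proof -
  have "(\<Sum>k. energy \<alpha> (g k)) = (\<integral>\<^sup>+ x. (\<Sum>k. local_energy \<alpha> (g k) x) \<partial>lborel)"
    unfolding energy_def by (rule nn_integral_suminf[symmetric]) measurable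
  also have "\<dots> = (\<integral>\<^sup>+ x. \<integral>\<^sup>+ y. (\<Sum>k. ennreal ((g k x - g k y)\<^sup>2 / \<bar>x - y\<bar> powr (1 + \<alpha>))) \<partial>lborel \<partial>lborel)"
    unfolding local_energy_def by (intro nn_integral_cong nn_integral_suminf[symmetric]) measurable
  also have "\<dots> \<le> energy \<alpha> f"
    unfolding energy_def local_energy_def
  proof (intro nn_integral_mono suminf_le_const)
    fix x y n
    have "(\<Sum>k<n. ennreal ((g k x - g k y)\<^sup>2 / \<bar>x - y\<bar> powr (1 + \<alpha>)))
      = ennreal ((\<Sum>k<n. (g k x - g k y)\<^sup>2) / \<bar>x - y\<bar> powr (1 + \<alpha>))"
      by (simp add: sum_ennreal sum_divide_distrib)
    also have "\<dots> \<le> ennreal ((f x - f y)\<^sup>2 / \<bar>x - y\<bar> powr (1 + \<alpha>))"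
      by (intro ennreal_leI divide_right_mono le) auto
    finally show "(\<Sum>k<n. ennreal ((g k x - g k y)\<^sup>2 / \<bar>x - y\<bar> powr (1 + \<alpha>)))
      \<le> ennreal ((f x - f y)\<^sup>2 / \<bar>x - y\<bar> powr (1 + \<alpha>))" .
  qed auto
  finally show ?thesis .
qed

text \<open>The part of \<open>z\<close> between the heights \<open>u\<close> and
  \<open>2 * u\<close>; layers at doubling heights stack without gap or overlap.\<close>

definition layer :: "real \<Rightarrow> real \<Rightarrow> real" where
  "layer u z = min (max (z - u) 0) u"

lemma layer_mono: "a \<le> b \<Longrightarrow> layer u a \<le> layer u b"
  by (auto simp: layer_def)

lemma layer_lipschitz: "\<bar>layer u a - layer u b\<bar> \<le> \<bar>a - b\<bar>"
  by (auto simp: layer_def)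

lemma sum_layer:
  assumes "0 < u"
  shows "(\<Sum>k<n. layer (2 ^ k * u) z) = min (max (z - u) 0) ((2 ^ n - 1) * u)"
proof (induction n)
  case (Suc n)
  define P where "P = 2 ^ n * u"
  have "u \<le> P" using assms by (simp add: P_def)
  then have "min (max (z - u) 0) (P - u) + layer P z = min (max (z - u) 0) (2 * P - u)"
    using assms by (auto simp: layer_def min_def max_def)
  then show ?case
    using Suc by (simp add: P_def algebra_simps)
qed (use assms in auto)

lemma sum_power2_le_power2_sum:
  fixes d :: "'a \<Rightarrow> real"
  assumes "finite A" "\<And>k. k \<in> A \<Longrightarrow> 0 \<le> d k"
  shows "(\<Sum>k\<in>A. (d k)\<^sup>2) \<le> (\<Sum>k\<in>A. d k)\<^sup>2"
  using assms
proof (induction A rule: finite_induct)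
  case (insert a A)
  have "0 \<le> d a * (\<Sum>k\<in>A. d k)" using insert by (intro mult_nonneg_nonneg sum_nonneg) auto
  then show ?case using insert by (simp add: power2_sum)
qed simp

text \<open>All layers are monotone, so their increments have one sign and the sum of squares is at
  most the square of the sum. By \<open>sum_layer\<close> that sum is the increment of a single
  truncation, which is 1-Lipschitz.\<close>

lemma sum_layer_diff_square_le:
  assumes u: "0 < u"
  shows "(\<Sum>k<n. (layer (2 ^ k * u) a - layer (2 ^ k * u) b)\<^sup>2) \<le> (a - b)\<^sup>2"
proof (induction a b rule: linorder_wlog)
  case (sym a b)
  then show ?case by (simp add: power2_commute)
next
  case (le a b)
  have "(\<Sum>k<n. (layer (2 ^ k * u) b - layer (2 ^ k * u) a)\<^sup>2)
    \<le> (\<Sum>k<n. layer (2 ^ k * u) b - layer (2 ^ k * u) a)\<^sup>2"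
    using le by (intro sum_power2_le_power2_sum) (auto intro: layer_mono)
  also have "\<dots> \<le> (b - a)\<^sup>2"
    using le u by (intro power_mono) (auto simp: sum_subtractf sum_layer)
  finally show ?case by (simp add: power2_commute)
qed

subsection \<open>Entropy\<close>

text \<open>Tangent line of the convex function \<open>t * ln t\<close> at 1.\<close>

lemma diff_one_le_mult_ln:
  assumes "0 \<le> t"
  shows "t - 1 \<le> t * ln (t :: real)"
proof (cases "t = 0")
  case False
  then have "t * (1 - 1 / t) \<le> t * ln t"
    using assms ln_le_minus_one[of "1 / t"] by (intro mult_left_mono) (auto simp: ln_div)
  then show ?thesis using False by (simp add: right_diff_distrib)
qed simp

text \<open>
  By convexity, \<open>Ent(h) \<le> \<integral> (h log (h / t) - h + t) d\<mu>\<close> for every \<open>t > 0\<close>.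
\<close>
lemma (in prob_space) Ent_le_nn_integral:
  assumes h: "integrable M h" "\<And>x. 0 \<le> h x" and t: "0 < t"
    and \<Phi>: "\<Phi> \<in> borel_measurable M" "\<And>x. 0 \<le> \<Phi> x"
    and le: "\<And>x. h x * ln (h x) \<le> h x * ln t + h x - t + \<Phi> x"
  shows "Ent M h \<le> enn2ereal (\<integral>\<^sup>+ x. ennreal (\<Phi> x) \<partial>M)"
proof (cases "(\<integral>\<^sup>+ x. ennreal (\<Phi> x) \<partial>M) = \<infinity>")
  case False
  have [measurable]: "h \<in> borel_measurable M" using h by auto
  have i\<Phi>: "integrable M \<Phi>"
    using False \<Phi> by (intro integrableI_nonneg) (auto simp: less_top)
  have lower: "h x - 1 \<le> h x * ln (h x)" for x
    using h(2) by (rule diff_one_le_mult_ln)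
  \<comment> \<open>\<open>h * ln h\<close> lies between two integrable functions.\<close>
  have iL: "integrable M (\<lambda>x. h x * ln (h x))"
  proof (rule Bochner_Integration.integrable_bound)
    show "integrable M (\<lambda>x. \<bar>h x - 1\<bar> + \<bar>h x * ln t + h x - t + \<Phi> x\<bar>)"
      by (intro Bochner_Integration.integrable_add integrable_abs Bochner_Integration.integrable_diff
          integrable_mult_left integrable_const h i\<Phi>)
    show "AE x in M. norm (h x * ln (h x)) \<le> norm (\<bar>h x - 1\<bar> + \<bar>h x * ln t + h x - t + \<Phi> x\<bar>)"
      using lower le by (intro AE_I2) (smt (verit) real_norm_def)
  qed measurable
  define p where "p = integral\<^sup>L M h"
  have p: "0 \<le> p" using h by (simp add: p_def)
  have "(\<integral>x. h x * ln (h x) \<partial>M) \<le> (\<integral>x. h x * ln t + h x - t + \<Phi> x \<partial>M)"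
    using iL h i\<Phi> le by (intro integral_mono) auto
  also have "\<dots> = p * ln t + p - t + integral\<^sup>L M \<Phi>"
    using h i\<Phi> by (simp add: p_def prob_space)
  finally have 1: "(\<integral>x. h x * ln (h x) \<partial>M) \<le> p * ln t + p - t + integral\<^sup>L M \<Phi>" .
  \<comment> \<open>As a function of \<open>t\<close>, \<open>p * ln t - t\<close> is largest at
    \<open>t = p\<close>; hence every \<open>t\<close> gives an upper bound.\<close>
  have "p * ln t + p - t - p * ln p \<le> 0"
  proof (cases "p = 0")
    case False
    then have "p * ln (t / p) \<le> p * (t / p - 1)"
      using p t by (intro mult_left_mono ln_le_minus_one) auto
    then show ?thesis using p t False by (simp add: ln_div algebra_simps)
  qed (use t in auto)
  with 1 have "(\<integral>x. h x * ln (h x) \<partial>M) - p * ln p \<le> integral\<^sup>L M \<Phi>" by simp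
  then show ?thesis
    using \<Phi> i\<Phi> iL unfolding Ent_def p_def[symmetric]
    by (simp add: ext_integral_eq_integral nn_integral_eq_integral enn2ereal_ennreal)
qed auto

text \<open>Handles an \<open>f\<close> that is almost everywhere constant, where the scale
  \<open>N\<close> used below may vanish.\<close>

lemma (in prob_space) Ent_AE_const:
  assumes "AE x in M. h x = c" "h \<in> borel_measurable M"
  shows "Ent M h = 0"
proof -
  have "(\<integral>\<^sup>+ x. ennreal (h x * ln (h x)) \<partial>M) = (\<integral>\<^sup>+ x. ennreal (c * ln c) \<partial>M)"
    "(\<integral>\<^sup>+ x. ennreal (- (h x * ln (h x))) \<partial>M) = (\<integral>\<^sup>+ x. ennreal (- (c * ln c)) \<partial>M)"
    by (rule nn_integral_cong_AE, use assms(1) in eventually_elim, simp)+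
  then have "ext_integral M (\<lambda>x. h x * ln (h x)) = ext_integral M (\<lambda>x. c * ln c)"
    unfolding ext_integral_def by simp
  also have "\<dots> = ereal (c * ln c)"
    by (simp add: ext_integral_eq_integral prob_space)
  moreover have "integral\<^sup>L M h = integral\<^sup>L M (\<lambda>_. c)"
    using assms by (intro integral_cong_AE) auto
  ultimately show ?thesis
    unfolding Ent_def by (simp add: prob_space)
qed

text \<open>
  Bounds \<open>h log (h / t) - h + t\<close> for \<open>h = (c + g)\<^sup>2\<close> and \<open>t = c\<^sup>2 + N\<close>: the linear terms in \<open>g\<close> cancel,
  so no centring of \<open>f\<close> at its mean (Rothaus' lemma) is needed.
\<close>
definition entropy_error :: "real \<Rightarrow> real \<Rightarrow> real" where
  "entropy_error N g = 15 * g\<^sup>2 + 3 * N + 4 * g\<^sup>2 * ln (1 + 4 * g\<^sup>2 / N)"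

lemma entropy_error_nonneg: "0 < N \<Longrightarrow> 0 \<le> entropy_error N g"
  unfolding entropy_error_def
  by (intro add_nonneg_nonneg mult_nonneg_nonneg ln_ge_zero) auto

text \<open>If \<open>g^2 \<le> t\<close>, a quadratic bound around \<open>h = t\<close> suffices.
  The logarithmic term is for larger \<open>g\<close>, where \<open>c\<close> is dominated by
  \<open>g\<close>.\<close>

lemma mult_ln_le_entropy_error:
  fixes c g N :: real
  assumes N: "0 < N"
  defines "t \<equiv> c\<^sup>2 + N" and "h \<equiv> (c + g)\<^sup>2"
  shows "h * ln h \<le> h * ln t + h - t + entropy_error N g"
proof -
  have t: "0 < t" "N \<le> t" "c\<^sup>2 \<le> t" using N by (auto simp: t_def add_nonneg_pos)
  have h: "0 \<le> h" by (simp add: h_def)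
  have L: "0 \<le> ln (1 + 4 * g\<^sup>2 / N)" using N by (intro ln_ge_zero) auto
  then have L': "0 \<le> g\<^sup>2 * ln (1 + 4 * g\<^sup>2 / N)" by (intro mult_nonneg_nonneg) auto
  show ?thesis
  proof (cases "h = 0")
    case True
    have "c\<^sup>2 = g\<^sup>2" using True by (simp add: h_def) (metis add_eq_0_iff power2_minus)
    then show ?thesis using True L' N by (simp add: entropy_error_def t_def)
  next
    case False
    then have hp: "0 < h" using h by simp
    show ?thesis
    proof (cases "g\<^sup>2 \<le> t")
      case True
      have "h * ln (h / t) \<le> h * (h / t - 1)"
        using hp t by (intro mult_left_mono ln_le_minus_one) auto
      then have 1: "h * ln h - h * ln t - h + t \<le> (h - t)\<^sup>2 / t"
        using hp t by (simp add: ln_div field_simps power2_eq_square)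
      have "(h - t)\<^sup>2 = (2 * (c * g) + g\<^sup>2 - N)\<^sup>2"
        by (simp add: h_def t_def power2_eq_square algebra_simps)
      also have "\<dots> \<le> 3 * ((2 * (c * g))\<^sup>2 + (g\<^sup>2)\<^sup>2 + N\<^sup>2)"
      proof -
        have "(x + y - z)\<^sup>2 \<le> 3 * (x\<^sup>2 + y\<^sup>2 + z\<^sup>2)" for x y z :: real
          using sum_squares_ge_zero[of "x - y" "x + z"] zero_le_power2[of "y + z"]
          by (simp add: power2_eq_square algebra_simps)
        then show ?thesis .
      qed
      also have "\<dots> = 12 * (c\<^sup>2 * g\<^sup>2) + 3 * (g\<^sup>2 * g\<^sup>2) + 3 * (N * N)"
        by (simp add: power2_eq_square)
      \<comment> \<open>Each of \<open>c^2\<close>, \<open>g^2\<close> and \<open>N\<close> is at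
        most \<open>t\<close>, so a factor \<open>t\<close> splits off to cancel the
        denominator.\<close>
      also have "\<dots> \<le> 12 * (t * g\<^sup>2) + 3 * (t * g\<^sup>2) + 3 * (t * N)"
        using t N True by (intro add_mono mult_left_mono mult_right_mono) auto
      finally have "(h - t)\<^sup>2 / t \<le> 15 * g\<^sup>2 + 3 * N"
        using t by (simp add: field_simps)
      then show ?thesis using 1 L' by (simp add: entropy_error_def)
    next
      case big: False
      show ?thesis
      proof (cases "h \<le> t")
        case True
        then have "h * ln h \<le> h * ln t" using hp by (intro mult_left_mono) auto
        moreover have "0 \<le> 4 * g\<^sup>2 * ln (1 + 4 * g\<^sup>2 / N)" using L' by simp
        ultimately show ?thesis using big hp N t(1) unfolding entropy_error_def by linarith
      next
        case False
        \<comment> \<open>Aims at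
          \<open>(c + g)^2 \<le> 2 * c^2 + 2 * g^2 \<le> 4 * g^2\<close>.\<close>
        have "c\<^sup>2 \<le> g\<^sup>2" using big t by simp
        then have "h \<le> 4 * g\<^sup>2"
          using zero_le_power2[of "c - g"] by (simp add: h_def power2_eq_square algebra_simps)
        have lnd: "h * ln (h / t) = h * ln h - h * ln t"
          using hp t by (simp add: ln_div right_diff_distrib)
        have "h / t \<le> 4 * g\<^sup>2 / N"
          using \<open>h \<le> 4 * g\<^sup>2\<close> t N by (intro frac_le) auto
        then have "ln (h / t) \<le> ln (1 + 4 * g\<^sup>2 / N)"
          using hp t N by (intro ln_mono) (auto intro!: add_increasing)
        then have "h * ln (h / t) \<le> 4 * g\<^sup>2 * ln (1 + 4 * g\<^sup>2 / N)"
          using \<open>h \<le> 4 * g\<^sup>2\<close> hp False t by (intro mult_mono ln_ge_zero) auto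
        then show ?thesis
          using False N zero_le_power2[of g] unfolding entropy_error_def lnd by linarith
      qed
    qed
  qed
qed

text \<open>Order of magnitude of \<open>entropy_error N g\<close> on the shell
  \<open>2 ^ k * s < \<bar>g\<bar> \<le> 2 ^ Suc k * s\<close> with \<open>s^2 = N / 2\<close>:
  there \<open>g^2 \<le> 2 * 4 ^ k * N\<close>, hence
  \<open>1 + 4 * g^2 / N \<le> 9 * 4 ^ k\<close>.\<close>

definition level_weight :: "real \<Rightarrow> nat \<Rightarrow> real" where
  "level_weight N k = 4 ^ k * N * ln (9 * 4 ^ k)"

lemma two_le_ln_9_mult: "2 \<le> ln (9 * 4 ^ k :: real)"
proof -
  have "exp 2 = exp 1 * exp (1 :: real)" by (simp add: exp_add[symmetric])
  also have "\<dots> \<le> 3 * 3" using exp_le by (intro mult_mono) auto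
  also have "\<dots> \<le> 9 * 4 ^ k" by simp
  finally show ?thesis by (subst ln_ge_iff) auto
qed

lemma level_weight_nonneg: "0 \<le> N \<Longrightarrow> 0 \<le> level_weight N k"
  unfolding level_weight_def
  by (intro mult_nonneg_nonneg order_trans[OF _ two_le_ln_9_mult]) auto

lemma exists_level:
  fixes g N s :: real
  assumes N: "0 < N" and s: "0 < s" "s\<^sup>2 = N / 2" and g: "s < \<bar>g\<bar>"
  obtains k where "2 ^ k * s < \<bar>g\<bar>" "g\<^sup>2 \<le> level_weight N k"
    "entropy_error N g \<le> 25 * level_weight N k"
proof -
  obtain n where "\<bar>g\<bar> / s < 2 ^ n" using real_arch_pow[of 2 "\<bar>g\<bar> / s"] by auto
  then have n: "\<bar>g\<bar> \<le> 2 ^ n * s" using s by (simp add: field_simps)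
  \<comment> \<open>The least dyadic bound is not the zeroth because
    \<open>s < \<bar>g\<bar>\<close>; its predecessor \<open>k\<close> is the last level
    exceeded.\<close>
  define m where "m = (LEAST n. \<bar>g\<bar> \<le> 2 ^ n * s)"
  have m: "\<bar>g\<bar> \<le> 2 ^ m * s" unfolding m_def using n by (rule LeastI)
  then have "m \<noteq> 0" using g by (cases m) auto
  then obtain k where k: "m = Suc k" using not0_implies_Suc by blast
  have less: "2 ^ k * s < \<bar>g\<bar>"
    using not_less_Least[of k "\<lambda>n. \<bar>g\<bar> \<le> 2 ^ n * s"] k by (simp add: m_def not_le)
  have "\<bar>g\<bar>\<^sup>2 \<le> (2 ^ m * s)\<^sup>2" using m by (intro power_mono) auto
  also have "\<dots> = 2 * (4 ^ k * N)"
    using s by (simp add: k power_mult_distrib power2_eq_square flip: power_mult_distrib)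
  finally have g2: "g\<^sup>2 \<le> 2 * (4 ^ k * N)" by simp
  define P :: real where "P = 4 ^ k"
  define L where "L = ln (9 * P)"
  have P: "1 \<le> P" by (simp add: P_def)
  have L: "2 \<le> L" using two_le_ln_9_mult[of k] by (simp add: L_def P_def)
  have gP: "g\<^sup>2 \<le> 2 * (P * N)" using g2 by (simp add: P_def)
  have W: "level_weight N k = P * N * L" by (simp add: level_weight_def P_def L_def)
  have PN: "N \<le> P * N" using P N by simp
  have PNL: "2 * (P * N) \<le> P * N * L" using L PN N by simp
  have "ln (1 + 4 * g\<^sup>2 / N) \<le> L"
  proof -
    have "1 + 4 * g\<^sup>2 / N \<le> 9 * P"
    proof -
      have "4 * g\<^sup>2 / N \<le> 8 * P" using gP N by (simp add: field_simps)
      then show ?thesis using P by simp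
    qed
    then show ?thesis unfolding L_def using N by (intro ln_mono) (auto intro!: add_pos_nonneg)
  qed
  then have "g\<^sup>2 * ln (1 + 4 * g\<^sup>2 / N) \<le> 2 * (P * N) * L"
    using gP N P by (intro mult_mono ln_ge_zero) auto
  moreover have "2 * (P * N) * L = 2 * (P * N * L)"
    by simp
  moreover have "entropy_error N g = 15 * g\<^sup>2 + 3 * N + 4 * (g\<^sup>2 * ln (1 + 4 * g\<^sup>2 / N))"
    by (simp add: entropy_error_def)
  \<comment> \<open>As \<open>L \<ge> 2\<close>, the three terms of the error cost 15, 3/2 and 8
    times the weight; 25 rounds up.\<close>
  ultimately have "entropy_error N g \<le> 25 * level_weight N k"
    using gP PNL PN N unfolding W by linarith
  moreover have "g\<^sup>2 \<le> level_weight N k"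
    using gP PNL unfolding W by linarith
  ultimately show thesis using less by (intro that)
qed

text \<open>Covers the points below the first level; 15 rounds up
  \<open>15 / 2 + 3 + 4\<close>.\<close>

lemma entropy_error_small:
  assumes "0 < N" "g\<^sup>2 \<le> N / 2"
  shows "entropy_error N g \<le> 15 * N"
proof -
  have "ln (1 + 4 * g\<^sup>2 / N) \<le> 4 * g\<^sup>2 / N"
    using assms by (intro ln_add_one_self_le_self) auto
  also have "\<dots> \<le> 2" using assms by (simp add: field_simps)
  finally have "g\<^sup>2 * ln (1 + 4 * g\<^sup>2 / N) \<le> N / 2 * 2"
    using assms by (intro mult_mono ln_ge_zero) auto
  then show ?thesis using assms by (simp add: entropy_error_def)
qed

subsection \<open>Sufficiency of the tail condition\<close>

text \<open>
  The constant 18 is \<open>9 \<cdot> 2\<close>: the 9 is that of \<open>level_weight\<close>, the 2 comes from Markov's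
  inequality; it also makes \<open>ent_profile\<close> increasing on \<open>[0, 1]\<close>.
\<close>
definition ent_profile :: "real \<Rightarrow> real" where
  "ent_profile t = t * ln (18 / t)"

lemma ent_profile_nonneg: "0 \<le> t \<Longrightarrow> t \<le> 1 \<Longrightarrow> 0 \<le> ent_profile t"
  by (cases "t = 0") (auto simp: ent_profile_def le_divide_eq intro!: mult_nonneg_nonneg ln_ge_zero)

text \<open>Replacing \<open>ln (18 / s)\<close> by \<open>ln (18 / t)\<close> costs
  \<open>s * ln (t / s) \<le> t - s\<close>, which is absorbed because
  \<open>ln (18 / t) \<ge> 1\<close>.\<close>

lemma ent_profile_mono:
  assumes "0 \<le> s" "s \<le> t" "t \<le> 1"
  shows "ent_profile s \<le> ent_profile t"
proof (cases "s = 0")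
  case True
  then show ?thesis using ent_profile_nonneg[of t] assms by (simp add: ent_profile_def)
next
  case False
  then have s: "0 < s" "0 < t" using assms by auto
  have "18 \<le> 18 / t" using s assms by (simp add: field_simps)
  then have "exp 1 \<le> 18 / t" using exp_le by linarith
  then have L: "1 \<le> ln (18 / t)" using s by (subst ln_ge_iff) auto
  have "ln (18 / s) = ln (18 / t) + ln (t / s)" using s by (simp add: ln_div)
  then have "ent_profile s = s * ln (18 / t) + s * ln (t / s)"
    by (simp add: ent_profile_def distrib_left)
  also have "s * ln (t / s) \<le> s * (t / s - 1)"
    using s by (intro mult_left_mono ln_le_minus_one) auto
  also have "\<dots> = (t - s) * 1" using s by (simp add: field_simps)
  also have "\<dots> \<le> (t - s) * ln (18 / t)" using L assms by (intro mult_left_mono) auto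
  finally show ?thesis by (simp add: ent_profile_def algebra_simps)
qed

section \<open>Tails and sets far from a point\<close>

lemma exists_small_tail:
  fixes M :: "real measure"
  assumes "prob_space M" and M: "sets M = sets borel" and e: "0 < e"
  obtains R where "1 \<le> R" "measure M (- {-R<..<R :: real}) < e"
proof -
  interpret prob_space M by fact
  define A where "A n = - {- real n<..<real n}" for n
  have "(\<lambda>n. measure M (A n)) \<longlonglongrightarrow> measure M (\<Inter>n. A n)"
    by (rule finite_Lim_measure_decseq) (auto simp: A_def M decseq_def)
  moreover have "(\<Inter>n. A n) = {}"
  proof -
    have "\<exists>n. x \<in> {- real n<..<real n}" for x
      using reals_Archimedean2[of "\<bar>x\<bar>"] by (auto simp: abs_less_iff) (smt (verit))
    then show ?thesis unfolding A_def by blast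
  qed
  ultimately have "(\<lambda>n. measure M (A n)) \<longlonglongrightarrow> 0" by simp
  then have "eventually (\<lambda>n. measure M (A n) < e) sequentially"
    using e by (rule order_tendstoD)
  then obtain n where "\<And>m. m \<ge> n \<Longrightarrow> measure M (A m) < e"
    by (auto simp: eventually_sequentially)
  then have "measure M (A (Suc n)) < e" by simp
  then show thesis using that[of "real (Suc n)"] by (simp add: A_def)
qed

text \<open>Passes from centred tails to any set away from a centre in \<open>{-1..1}\<close>, and
  from \<open>ln (1 / m)\<close> to \<open>ln (18 / m)\<close>. For large \<open>\<rho>\<close> the
  set lies in a tail; for small \<open>\<rho>\<close> the profile is bounded.\<close>

lemma tail_ent_profile_bound:
  fixes M :: "real measure"
  assumes pr: "prob_space M" and M: "sets M = sets borel" and \<alpha>: "1 < \<alpha>"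
    and K: "\<And>r. 0 \<le> r \<Longrightarrow> r powr (\<alpha> - 1) * measure M (- {-r<..<r}) * ln (1 / measure M (- {-r<..<r})) \<le> K"
  obtains K' where "0 < K'" "\<And>\<rho> x A. \<lbrakk>0 \<le> \<rho>; \<bar>x\<bar> \<le> 1; A \<in> sets M; \<And>y. y \<in> A \<Longrightarrow> \<rho> \<le> \<bar>y - x\<bar>\<rbrakk>
     \<Longrightarrow> \<rho> powr (\<alpha> - 1) * ent_profile (measure M A) \<le> K'"
proof -
  interpret prob_space M by fact
  define m where "m r = measure M (- {-r<..<r :: real})" for r
  obtain R where R: "1 \<le> R" "m R < 1 / 2"
    using exists_small_tail[OF pr M, of "1/2"] unfolding m_def by auto
  \<comment> \<open>Chosen so that \<open>ln (18 / m) \<le> c * ln (1 / m)\<close> whenever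
    \<open>0 < m \<le> 1 / 2\<close>.\<close>
  define c where "c = ln 18 / ln 2 + (1 :: real)"
  have c: "c > 0" by (simp add: c_def add_pos_pos)
  \<comment> \<open>At \<open>r = 0\<close> the bounded quantity is 0, as
    \<open>0 powr (\<alpha> - 1) = 0\<close>.\<close>
  have K0: "K \<ge> 0" using K[of 0] \<alpha> by simp
  \<comment> \<open>The first term serves \<open>\<rho> \<le> 2 * R\<close>, the second larger
    \<open>\<rho>\<close>; the 1 makes the constant positive.\<close>
  define K' where "K' = (2 * R) powr (\<alpha> - 1) * ent_profile 1 + 2 powr (\<alpha> - 1) * (c * K) + 1"
  have e1: "0 \<le> ent_profile 1" by (rule ent_profile_nonneg) auto
  then have K': "0 < K'" using c K0 by (auto simp: K'_def intro!: add_nonneg_pos)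
  have far: "r powr (\<alpha> - 1) * ent_profile (m r) \<le> c * K" if "R \<le> r" for r
  proof (cases "m r = 0")
    case False
    then have m: "0 < m r" by (simp add: m_def zero_less_measure_iff)
    have "m r \<le> m R" unfolding m_def using that by (intro finite_measure_mono) (auto simp: M)
    then have "ln 2 \<le> ln (1 / m r)" using R m by (intro ln_mono) (auto simp: field_simps)
    then have "ln 18 \<le> ln 18 / ln 2 * ln (1 / m r)"
      by (simp add: field_simps)
    then have "ln (18 / m r) \<le> c * ln (1 / m r)"
      using m by (simp add: ln_div c_def algebra_simps)
    then have "r powr (\<alpha> - 1) * (m r * ln (18 / m r)) \<le> r powr (\<alpha> - 1) * (m r * (c * ln (1 / m r)))"
      using m by (intro mult_left_mono) auto
    also have "\<dots> = c * (r powr (\<alpha> - 1) * m r * ln (1 / m r))" by simp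
    also have "\<dots> \<le> c * K" using K[of r] c that R unfolding m_def[symmetric] by (intro mult_left_mono) auto
    finally show ?thesis by (simp add: ent_profile_def)
  qed (use c K0 in \<open>simp add: ent_profile_def\<close>)
  show thesis
  proof (rule that[OF K'])
    fix \<rho> x :: real and A
    assume \<rho>: "0 \<le> \<rho>" and x: "\<bar>x\<bar> \<le> 1" and A: "A \<in> sets M" "\<And>y. y \<in> A \<Longrightarrow> \<rho> \<le> \<bar>y - x\<bar>"
    show "\<rho> powr (\<alpha> - 1) * ent_profile (measure M A) \<le> K'"
    proof (cases "\<rho> \<le> 2 * R")
      case True
      have "\<rho> powr (\<alpha> - 1) * ent_profile (measure M A) \<le> (2 * R) powr (\<alpha> - 1) * ent_profile 1"
        using True \<rho> \<alpha> by (intro mult_mono powr_mono2 ent_profile_mono ent_profile_nonneg) auto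
      moreover have "0 \<le> 2 powr (\<alpha> - 1) * (c * K)" using c K0 by simp
      ultimately show ?thesis by (simp add: K'_def)
    next
      case False
      \<comment> \<open>\<open>\<bar>y\<bar> \<ge> \<rho> - 1 \<ge> \<rho> / 2\<close>, since
        \<open>\<rho> > 2 * R \<ge> 2\<close>.\<close>
      have "A \<subseteq> - {-(\<rho>/2)<..<\<rho>/2}"
        using A(2) x False R by fastforce
      then have "measure M A \<le> m (\<rho>/2)"
        unfolding m_def by (intro finite_measure_mono) (auto simp: M)
      then have "\<rho> powr (\<alpha> - 1) * ent_profile (measure M A) \<le> \<rho> powr (\<alpha> - 1) * ent_profile (m (\<rho>/2))"
        by (intro mult_left_mono ent_profile_mono) (auto simp: m_def)
      also have "\<dots> = 2 powr (\<alpha> - 1) * ((\<rho>/2) powr (\<alpha> - 1) * ent_profile (m (\<rho>/2)))"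
        using \<rho> by (simp add: powr_divide)
      also have "\<dots> \<le> 2 powr (\<alpha> - 1) * (c * K)"
        using far[of "\<rho>/2"] False by (intro mult_left_mono) auto
      also have "\<dots> \<le> K'" using e1 by (simp add: K'_def)
      finally show ?thesis .
    qed
  qed
qed

section \<open>Summation over the level sets\<close>

lemma square_two_power_mult: "(2 ^ k * x)\<^sup>2 = 4 ^ k * (x :: real)\<^sup>2"
  using power_mult[of "2 :: real" 2 k] power_mult[of "2 :: real" k 2]
  by (simp add: power_mult_distrib mult.commute)

text \<open>A positive mass \<open>t\<close> below the Markov bound has
  \<open>9 * 4 ^ k \<le> 18 / t\<close>, so the logarithm of the level can be traded for that of the
  profile.\<close>

lemma level_weight_measure_le:
  assumes N: "0 < N" and t: "0 \<le> t" "t \<le> 2 / 4 ^ k"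
  shows "level_weight N k * t \<le> 4 ^ k * N * ent_profile t"
proof (cases "t = 0")
  case False
  then have "ln (9 * 4 ^ k) \<le> ln (18 / t)"
    using t by (intro ln_mono) (auto simp: field_simps)
  then have "4 ^ k * N * t * ln (9 * 4 ^ k) \<le> 4 ^ k * N * t * ln (18 / t)"
    using N t by (intro mult_left_mono) auto
  then show ?thesis by (simp add: level_weight_def ent_profile_def mult_ac)
qed (simp add: ent_profile_def)

lemma (in prob_space) measure_level_le:
  fixes g :: "'a \<Rightarrow> real" and N s :: real
  assumes g: "g \<in> borel_measurable M" "integrable M (\<lambda>x. (g x)\<^sup>2)"
    and N: "N = (\<integral>x. (g x)\<^sup>2 \<partial>M)" "0 < N" and s: "0 < s" "s\<^sup>2 = N / 2"
  shows "measure M {x \<in> space M. 2 ^ k * s < \<bar>g x\<bar>} \<le> 2 / 4 ^ k"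
proof -
  have [measurable]: "g \<in> borel_measurable M" by fact
  have "measure M {x \<in> space M. 2 ^ k * s < \<bar>g x\<bar>} \<le> measure M {x \<in> space M. 4 ^ k * N / 2 \<le> (g x)\<^sup>2}"
  proof (rule finite_measure_mono)
    have "4 ^ k * N / 2 \<le> (g x)\<^sup>2" if "2 ^ k * s < \<bar>g x\<bar>" for x
    proof -
      have "(2 ^ k * s)\<^sup>2 \<le> \<bar>g x\<bar>\<^sup>2" using that s by (intro power_mono) auto
      also have "(2 ^ k * s)\<^sup>2 = 4 ^ k * N / 2" using s by (simp add: square_two_power_mult)
      finally show ?thesis by simp
    qed
    then show "{x \<in> space M. 2 ^ k * s < \<bar>g x\<bar>} \<subseteq> {x \<in> space M. 4 ^ k * N / 2 \<le> (g x)\<^sup>2}" by auto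
  qed measurable
  also have "\<dots> \<le> N / (4 ^ k * N / 2)"
    unfolding N(1) using g N
    by (intro integral_Markov_inequality_measure[where A = "space M"]) auto
  also have "\<dots> = 2 / 4 ^ k" using N by simp
  finally show ?thesis .
qed

text \<open>The factor 440 is \<open>8 * 55\<close>: 8 from \<open>(u k)^2 = 4 ^ k * N / 8\<close>,
  and \<open>55 = 15 * 2 + 25\<close> from \<open>N \<le> 2 * S\<close> in the final
  estimate.\<close>

lemma log_Sobolev_of_profile_bound:
  fixes M :: "real measure"
  assumes "prob_space M" and M[measurable_cong]: "sets M = sets borel" and ac: "absolutely_continuous lborel M"
    and \<alpha>: "1 < \<alpha>" and K': "0 < K'"
    and prof: "\<And>\<rho> x A. \<lbrakk>0 \<le> \<rho>; \<bar>x\<bar> \<le> 1; A \<in> sets M; \<And>y. y \<in> A \<Longrightarrow> \<rho> \<le> \<bar>y - x\<bar>\<rbrakk>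
     \<Longrightarrow> \<rho> powr (\<alpha> - 1) * ent_profile (measure M A) \<le> K'"
    and f[measurable]: "f \<in> borel_measurable borel" and int: "integrable M (\<lambda>x. (f x)\<^sup>2)"
    and fin: "energy \<alpha> f < \<infinity>"
  shows "Ent M (\<lambda>x. (f x)\<^sup>2) \<le> ereal (440 * K' * morrey_const \<alpha>) * enn2ereal (energy \<alpha> f)"
proof -
  interpret prob_space M by fact
  have sp: "space M = UNIV" using sets_eq_imp_space_eq[OF M] by simp
  have C0: "0 < morrey_const \<alpha>" using \<alpha> by (rule morrey_const_pos)
  define G where "G = {x. local_energy \<alpha> f x < \<infinity>}"
  have [measurable]: "G \<in> sets borel" unfolding G_def by measurable
  have "AE x in lborel. local_energy \<alpha> f x \<noteq> \<infinity>"
    using fin unfolding energy_def by (intro nn_integral_PInf_AE) auto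
  then have AEG: "AE x in lborel. x \<in> G"
    by (simp add: G_def less_top)
  have AEGM: "AE x in M. x \<in> G"
    by (rule absolutely_continuous_AE[OF _ ac AEG]) (simp add: M)
  \<comment> \<open>A null set cannot cover \<open>{-1..1}\<close>; the bound on the centre is the
    one required by \<open>prof\<close>.\<close>
  have "\<exists>x\<in>G. \<bar>x\<bar> \<le> 1"
  proof (rule ccontr)
    assume "\<not> ?thesis"
    then have "AE x in lborel. x \<notin> {-1..1 :: real}"
      using AEG by (auto elim!: eventually_mono simp: abs_le_iff)
    then have "emeasure lborel {-1..1 :: real} = 0"
      by (subst (asm) AE_iff_measurable[of "{-1..1}"]) auto
    then show False by simp
  qed
  then obtain x0 where x0: "x0 \<in> G" "\<bar>x0\<bar> \<le> 1" by blast
  define c where "c = f x0"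
  define g where "g x = f x - c" for x
  have [measurable]: "g \<in> borel_measurable borel" unfolding g_def[abs_def] by measurable
  have intf: "integrable M f"
    by (rule square_integrable_imp_integrable) (use int in auto)
  have intg: "integrable M (\<lambda>x. (g x)\<^sup>2)"
    using int intf by (simp add: g_def power2_diff)
  define N where "N = (\<integral>x. (g x)\<^sup>2 \<partial>M)"
  have "0 \<le> N" by (simp add: N_def)
  show ?thesis
  proof (cases "N = 0")
    case True
    then have "AE x in M. (g x)\<^sup>2 = 0"
      using intg by (subst (asm) N_def, subst (asm) integral_nonneg_eq_0_iff_AE) auto
    then have "Ent M (\<lambda>x. (f x)\<^sup>2) = 0"
      by (intro Ent_AE_const[of _ "c\<^sup>2"]) (auto simp: g_def elim!: eventually_mono)
    then show ?thesis using K' C0 by (simp add: ereal_0_le_mult)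
  next
    case False
    then have N: "0 < N" using \<open>0 \<le> N\<close> by simp
    define s where "s = sqrt (N / 2)"
    have s: "0 < s" "s\<^sup>2 = N / 2" using N by (auto simp: s_def)
    define A where "A k = {x. 2 ^ k * s < \<bar>g x\<bar>}" for k
    have [measurable]: "A k \<in> sets borel" for k unfolding A_def by measurable
    \<comment> \<open>Half of \<open>s\<close>, so that layer \<open>k\<close> reaches its plateau
      at \<open>2 * u k = 2 ^ k * s\<close>, the threshold of \<open>A k\<close>.\<close>
    define u where "u k = 2 ^ k * (s / 2)" for k
    have u: "0 < u k" for k using s by (simp add: u_def)
    have u2: "(u k)\<^sup>2 = 4 ^ k * N / 8" for k
      using s by (simp add: u_def square_two_power_mult power_divide)
    define h where "h k x = layer (u k) \<bar>g x\<bar>" for k x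
    have [measurable]: "h k \<in> borel_measurable borel" for k
      unfolding h_def[abs_def] layer_def by measurable
    have hlip: "\<bar>h k x - h k y\<bar> \<le> \<bar>f x - f y\<bar>" for k x y
      unfolding h_def by (rule order_trans[OF layer_lipschitz]) (simp add: g_def abs_triangle_ineq3)
    have hsum: "(\<Sum>k. energy \<alpha> (h k)) \<le> energy \<alpha> f"
    proof (rule suminf_energy_le)
      fix n x y
      have "(\<Sum>k<n. (h k x - h k y)\<^sup>2) \<le> (\<bar>g x\<bar> - \<bar>g y\<bar>)\<^sup>2"
        unfolding h_def u_def using s by (intro sum_layer_diff_square_le) simp
      also have "\<dots> \<le> (f x - f y)\<^sup>2"
        by (rule abs_le_square_iff[THEN iffD1]) (simp add: g_def abs_triangle_ineq3)
      finally show "(\<Sum>k<n. (h k x - h k y)\<^sup>2) \<le> (f x - f y)\<^sup>2" .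
    qed measurable
    define E where "E k = enn2real (energy \<alpha> (h k))" for k
    have finh: "energy \<alpha> (h k) < \<infinity>" for k
      using energy_contraction(2)[OF hlip] fin by (rule le_less_trans)
    have EE: "energy \<alpha> (h k) = ennreal (E k)" for k
      using finh[of k] by (simp add: E_def)
    \<comment> \<open>Morrey's inequality is applied to the layer, which is bounded even if
      \<open>f\<close> is not; it yields the layer's own energy \<open>E k\<close>, and these can be
      summed over \<open>k\<close>.\<close>
    have key: "(u k)\<^sup>2 * ent_profile (measure M (A k)) \<le> K' * (morrey_const \<alpha> * E k)" for k
    proof -
      have E0: "0 \<le> E k" by (simp add: E_def)
      have far: "(u k)\<^sup>2 \<le> morrey_const \<alpha> * \<bar>x - x0\<bar> powr (\<alpha> - 1) * E k" if "x \<in> A k \<inter> G" for x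
      proof -
        have "h k x = u k" "h k x0 = 0"
          using that s u[of k] by (auto simp: h_def layer_def g_def c_def A_def u_def)
        moreover have "(h k x - h k x0)\<^sup>2 \<le> morrey_const \<alpha> * \<bar>x - x0\<bar> powr (\<alpha> - 1) * E k"
          unfolding E_def
        proof (rule morrey[OF \<alpha>])
          show "\<bar>h k z\<bar> \<le> u k" for z using u[of k] by (auto simp: h_def layer_def)
          show "local_energy \<alpha> (h k) x < \<infinity>" "local_energy \<alpha> (h k) x0 < \<infinity>"
            using le_less_trans[OF energy_contraction(1)[of "h k" f, OF hlip]] that x0(1)
            by (auto simp: G_def)
        qed (use finh in auto)
        ultimately show ?thesis by simp
      qed
      have mA: "measure M (A k) = measure M (A k \<inter> G)"
        using AEGM by (intro finite_measure_eq_AE) auto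
      show ?thesis
      proof (cases "E k = 0")
        case True
        \<comment> \<open>With zero energy a good point of \<open>A k\<close> would force
          \<open>u k = 0\<close>.\<close>
        then have "A k \<inter> G = {}" using far u[of k] by fastforce
        then show ?thesis using mA True by (simp add: ent_profile_def)
      next
        case False
        then have E: "0 < E k" using E0 by simp
        \<comment> \<open>\<open>\<rho>\<close> solves \<open>(u k)^2 = morrey_const \<alpha> *
          \<rho> powr (\<alpha> - 1) * E k\<close>: no good point of \<open>A k\<close> is closer to
          \<open>x0\<close>.\<close>
        define \<tau> where "\<tau> = (u k)\<^sup>2 / (morrey_const \<alpha> * E k)"
        define \<rho> where "\<rho> = \<tau> powr (1 / (\<alpha> - 1))"
        have \<tau>: "0 < \<tau>" using E C0 u[of k] by (simp add: \<tau>_def)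
        have \<rho>: "\<rho> powr (\<alpha> - 1) = \<tau>" using \<tau> \<alpha> by (simp add: \<rho>_def powr_powr)
        have "\<rho> powr (\<alpha> - 1) * ent_profile (measure M (A k \<inter> G)) \<le> K'"
        proof (rule prof[OF _ x0(2)])
          show "0 \<le> \<rho>" by (simp add: \<rho>_def)
          fix y assume "y \<in> A k \<inter> G"
          then have "\<rho> powr (\<alpha> - 1) \<le> \<bar>y - x0\<bar> powr (\<alpha> - 1)"
            unfolding \<rho> using far[of y] E C0 by (simp add: \<tau>_def field_simps)
          then show "\<rho> \<le> \<bar>y - x0\<bar>"
            using \<alpha> \<rho> \<tau> by (smt (verit) powr_less_mono2 abs_ge_zero)
        qed (simp add: M)
        then show ?thesis unfolding \<rho> mA using E C0 by (simp add: \<tau>_def field_simps)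
      qed
    qed
    define S where "S = (\<Sum>k. ennreal (level_weight N k) * emeasure M (A k))"
    have lw: "0 \<le> level_weight N k" for k
      using N by (simp add: level_weight_nonneg)
    have S: "S \<le> ennreal (8 * K' * morrey_const \<alpha>) * energy \<alpha> f"
    proof -
      have "ennreal (level_weight N k) * emeasure M (A k)
        \<le> ennreal (8 * K' * morrey_const \<alpha>) * energy \<alpha> (h k)" for k
      proof -
        have "measure M (A k) \<le> 2 / 4 ^ k"
          using measure_level_le[OF _ intg N_def N s, of k] by (simp add: A_def sp)
        then have "level_weight N k * measure M (A k) \<le> 4 ^ k * N * ent_profile (measure M (A k))"
          using N by (intro level_weight_measure_le) auto
        also have "\<dots> = 8 * ((u k)\<^sup>2 * ent_profile (measure M (A k)))" by (simp add: u2)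
        also have "\<dots> \<le> 8 * (K' * (morrey_const \<alpha> * E k))" using key[of k] by simp
        finally have "ennreal (level_weight N k * measure M (A k)) \<le> ennreal (8 * K' * morrey_const \<alpha> * E k)"
          by (intro ennreal_leI) (simp add: mult_ac)
        moreover have "ennreal (level_weight N k) * emeasure M (A k) = ennreal (level_weight N k * measure M (A k))"
          using lw by (simp add: emeasure_eq_measure ennreal_mult')
        moreover have "ennreal (8 * K' * morrey_const \<alpha>) * energy \<alpha> (h k) = ennreal (8 * K' * morrey_const \<alpha> * E k)"
          unfolding EE by (rule ennreal_mult'[symmetric]) (use K' C0 in simp)
        ultimately show ?thesis by simp
      qed
      then have "S \<le> (\<Sum>k. ennreal (8 * K' * morrey_const \<alpha>) * energy \<alpha> (h k))"
        unfolding S_def by (intro suminf_le) auto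
      also have "\<dots> = ennreal (8 * K' * morrey_const \<alpha>) * (\<Sum>k. energy \<alpha> (h k))"
        by (rule ennreal_suminf_cmult)
      also have "\<dots> \<le> ennreal (8 * K' * morrey_const \<alpha>) * energy \<alpha> f"
        by (intro mult_left_mono hsum) auto
      finally show ?thesis .
    qed
    \<comment> \<open>Sums the weights of all levels exceeded at \<open>x\<close>. By
      \<open>exists_level\<close> a single one already dominates \<open>g^2\<close> and, up to the
      factor 25, the error.\<close>
    define W where "W x = (\<Sum>k. ennreal (level_weight N k) * indicator (A k) x)" for x
    have [measurable]: "W \<in> borel_measurable borel" unfolding W_def[abs_def] by measurable
    have intW: "(\<integral>\<^sup>+ x. W x \<partial>M) = S"
      unfolding W_def S_def by (subst nn_integral_suminf) (auto simp: nn_integral_cmult_indicator M)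
    have W: "ennreal ((g x)\<^sup>2) \<le> ennreal (N / 2) + W x"
        "ennreal (entropy_error N (g x)) \<le> ennreal (15 * N) + 25 * W x" for x
    proof -
      have "ennreal ((g x)\<^sup>2) \<le> ennreal (N / 2) + W x \<and>
        ennreal (entropy_error N (g x)) \<le> ennreal (15 * N) + 25 * W x"
      proof (cases "\<bar>g x\<bar> \<le> s")
        case True
        then have "(g x)\<^sup>2 \<le> N / 2"
          using s by (metis abs_le_square_iff abs_of_pos)
        then show ?thesis
          using entropy_error_small[OF N] by (auto intro!: ennreal_leI add_increasing2)
      next
        case False
        then obtain k where k: "2 ^ k * s < \<bar>g x\<bar>" "(g x)\<^sup>2 \<le> level_weight N k"
            "entropy_error N (g x) \<le> 25 * level_weight N k"
          using exists_level[OF N s, of "g x"] by auto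
        have lwW: "ennreal (level_weight N k) \<le> W x"
        proof -
          have "ennreal (level_weight N k) = (\<Sum>j\<in>{k}. ennreal (level_weight N j) * indicator (A j) x)"
            using k(1) by (simp add: A_def)
          also have "\<dots> \<le> W x" unfolding W_def by (rule sum_le_suminf) auto
          finally show ?thesis .
        qed
        have "ennreal ((g x)\<^sup>2) \<le> W x"
          using ennreal_leI[OF k(2)] lwW by (rule order_trans)
        moreover have "ennreal (entropy_error N (g x)) \<le> 25 * W x"
        proof -
          have "ennreal (entropy_error N (g x)) \<le> ennreal (25 * level_weight N k)"
            using k(3) by (rule ennreal_leI)
          also have "\<dots> = 25 * ennreal (level_weight N k)"
            using lw by (simp add: ennreal_mult)
          also have "\<dots> \<le> 25 * W x"
            using lwW by (rule mult_left_mono) simp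
          finally show ?thesis .
        qed
        ultimately show ?thesis
          by (intro conjI add_increasing zero_le)
      qed
      then show "ennreal ((g x)\<^sup>2) \<le> ennreal (N / 2) + W x"
        "ennreal (entropy_error N (g x)) \<le> ennreal (15 * N) + 25 * W x" by (rule conjunct1, rule conjunct2)
    qed
    \<comment> \<open>Points below the first threshold \<open>s^2 = N / 2\<close> contribute at most
      half of \<open>N\<close>, the integral of \<open>g^2\<close>. This half is absorbed on the
      left if \<open>S\<close> is finite.\<close>
    have NS: "ennreal N \<le> 2 * S"
    proof -
      have "ennreal N = (\<integral>\<^sup>+ x. ennreal ((g x)\<^sup>2) \<partial>M)"
        unfolding N_def using intg by (subst nn_integral_eq_integral) auto
      also have "\<dots> \<le> (\<integral>\<^sup>+ x. ennreal (N / 2) + W x \<partial>M)" by (intro nn_integral_mono W)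
      also have "\<dots> = ennreal (N / 2) + S"
        by (subst nn_integral_add) (auto simp: intW emeasure_space_1)
      finally have le: "ennreal N \<le> ennreal (N / 2) + S" .
      show ?thesis
      proof (cases S)
        case (real r)
        then have "ennreal N \<le> ennreal (N / 2 + r)" using le N by simp
        then have "N \<le> N / 2 + r" using real N by (subst (asm) ennreal_le_iff) auto
        then have "N \<le> 2 * r" by simp
        then have "ennreal N \<le> ennreal (2 * r)" by (rule ennreal_leI)
        then show ?thesis using real by (simp add: ennreal_mult)
      qed simp
    qed
    have "Ent M (\<lambda>x. (f x)\<^sup>2) \<le> enn2ereal (\<integral>\<^sup>+ x. ennreal (entropy_error N (g x)) \<partial>M)"
    proof (rule Ent_le_nn_integral[where t = "c\<^sup>2 + N"])
      show "(\<lambda>x. entropy_error N (g x)) \<in> borel_measurable M"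
        unfolding entropy_error_def by measurable
      show "(f x)\<^sup>2 * ln ((f x)\<^sup>2) \<le> (f x)\<^sup>2 * ln (c\<^sup>2 + N) + (f x)\<^sup>2 - (c\<^sup>2 + N) + entropy_error N (g x)" for x
        using mult_ln_le_entropy_error[OF N, of c "g x"] by (simp add: g_def)
    qed (use int N in \<open>auto intro: add_nonneg_pos entropy_error_nonneg\<close>)
    also have "(\<integral>\<^sup>+ x. ennreal (entropy_error N (g x)) \<partial>M) \<le> (\<integral>\<^sup>+ x. ennreal (15 * N) + 25 * W x \<partial>M)"
      by (intro nn_integral_mono W)
    also have "\<dots> = ennreal (15 * N) + 25 * S"
      by (subst nn_integral_add) (auto simp: intW emeasure_space_1 nn_integral_cmult)
    also have "\<dots> = 15 * ennreal N + 25 * S" using N by (simp add: ennreal_mult)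
    also have "\<dots> \<le> 15 * (2 * S) + 25 * S" by (intro add_mono mult_left_mono NS) auto
    also have "\<dots> = 55 * S" by (simp add: mult.assoc[symmetric] distrib_right[symmetric])
    also have "\<dots> \<le> 55 * (ennreal (8 * K' * morrey_const \<alpha>) * energy \<alpha> f)"
      by (intro mult_left_mono S) auto
    also have "\<dots> = ennreal (440 * K' * morrey_const \<alpha>) * energy \<alpha> f"
    proof -
      have "ennreal (440 * K' * morrey_const \<alpha>) = ennreal 55 * ennreal (8 * K' * morrey_const \<alpha>)"
        using K' C0 by (subst ennreal_mult[symmetric]) (auto simp: mult_ac)
      then show ?thesis by (simp add: mult.assoc)
    qed
    finally show ?thesis
      using K' C0 by (simp add: times_ennreal.rep_eq enn2ereal_ennreal less_eq_ennreal.rep_eq)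
  qed
qed

subsection \<open>Necessity of the tail condition\<close>

text \<open>Dominates the energy integrand of \<open>ramp r\<close>, which has range in
  \<open>{0..1}\<close> and Lipschitz constant \<open>2 / r\<close>.\<close>

definition truncated_kernel :: "real \<Rightarrow> real \<Rightarrow> real \<Rightarrow> real" where
  "truncated_kernel \<alpha> r z = min 1 (4 * (z / r)\<^sup>2) / \<bar>z\<bar> powr (1 + \<alpha>)"

lemma measurable_truncated_kernel [measurable]: "truncated_kernel \<alpha> r \<in> borel_measurable borel"
  unfolding truncated_kernel_def[abs_def] by measurable

lemma truncated_kernel_minus: "truncated_kernel \<alpha> r (- z) = truncated_kernel \<alpha> r z"
  by (simp add: truncated_kernel_def)

text \<open>Near 0 the kernel is of order \<open>\<bar>z\<bar> powr (1 - \<alpha>)\<close>,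
  integrable as \<open>\<alpha> < 2\<close>; far away
  \<open>\<bar>z\<bar> powr (- 1 - \<alpha>)\<close> is integrable as \<open>\<alpha> > 0\<close>.
  \<open>h\<close> lives on the half-line, and its reflection covers the rest.\<close>

lemma nn_integral_truncated_kernel_finite:
  assumes \<alpha>: "0 < \<alpha>" "\<alpha> < 2"
  shows "(\<integral>\<^sup>+ z. ennreal (truncated_kernel \<alpha> 1 z) \<partial>lborel) < \<infinity>"
proof -
  define h where "h z = indicator {0..1} z * ennreal (4 * z powr (1 - \<alpha>))
     + indicator {1..} z * ennreal (z powr (- 1 - \<alpha>))" for z :: real
  have [measurable]: "h \<in> borel_measurable borel" unfolding h_def[abs_def] by measurable
  have "(\<integral>\<^sup>+ z. h z \<partial>lborel) < \<infinity>"
  proof -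
    have "((\<lambda>z. 4 * z powr (1 - \<alpha>)) has_integral 4 * (1 powr (1 - \<alpha> + 1) / (1 - \<alpha> + 1))) {0..1}"
      using \<alpha> by (intro has_integral_mult_right has_integral_powr_from_0) auto
    from nn_integral_has_integral_lebesgue[OF _ this]
    have 1: "(\<integral>\<^sup>+ z. indicator {0..1} z * ennreal (4 * z powr (1 - \<alpha>)) \<partial>lborel) < \<infinity>"
      by (simp add: ennreal_mult' ennreal_indicator)
    have "((\<lambda>z. z powr (- 1 - \<alpha>)) has_integral - (1 powr (- 1 - \<alpha> + 1)) / (- 1 - \<alpha> + 1)) {1..}"
      using \<alpha> by (intro has_integral_powr_to_inf) auto
    from nn_integral_has_integral_lebesgue[OF _ this]
    have 2: "(\<integral>\<^sup>+ z. indicator {1..} z * ennreal (z powr (- 1 - \<alpha>)) \<partial>lborel) < \<infinity>"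
      by (simp add: ennreal_mult' ennreal_indicator)
    show ?thesis using 1 2 unfolding h_def by (subst nn_integral_add) auto
  qed
  moreover have "(\<integral>\<^sup>+ z. h (- z) \<partial>lborel) = (\<integral>\<^sup>+ z. h z \<partial>lborel)"
    using nn_integral_real_affine[of h "- 1" 0] by simp
  moreover have "(\<integral>\<^sup>+ z. ennreal (truncated_kernel \<alpha> 1 z) \<partial>lborel) \<le> (\<integral>\<^sup>+ z. h z + h (- z) \<partial>lborel)"
  proof (rule nn_integral_mono)
    fix z :: real
    have near: "truncated_kernel \<alpha> 1 z \<le> 4 * \<bar>z\<bar> powr (1 - \<alpha>)"
    proof (cases "z = 0")
      case False
      then have "\<bar>z\<bar> powr (1 - \<alpha>) * \<bar>z\<bar> powr (1 + \<alpha>) = z\<^sup>2"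
        by (simp flip: powr_add)
      then show ?thesis using False by (simp add: truncated_kernel_def divide_le_eq mult.assoc)
    qed (simp add: truncated_kernel_def)
    have far: "truncated_kernel \<alpha> 1 z \<le> \<bar>z\<bar> powr (- 1 - \<alpha>)"
    proof -
      have "truncated_kernel \<alpha> 1 z \<le> 1 / \<bar>z\<bar> powr (1 + \<alpha>)"
        unfolding truncated_kernel_def by (intro divide_right_mono) auto
      also have "\<dots> = \<bar>z\<bar> powr (- (1 + \<alpha>))" by (rule powr_minus_divide[symmetric])
      finally show ?thesis by (simp add: algebra_simps)
    qed
    have H: "ennreal (truncated_kernel \<alpha> 1 z) \<le> h \<bar>z\<bar>"
      using near far unfolding h_def
      by (cases "\<bar>z\<bar> \<le> 1") (auto intro!: ennreal_leI add_increasing2)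
    show "ennreal (truncated_kernel \<alpha> 1 z) \<le> h z + h (- z)"
      using H by (cases "0 \<le> z") (auto intro: add_increasing add_increasing2)
  qed
  ultimately show ?thesis
    by (subst (asm) nn_integral_add) (auto intro: le_less_trans)
qed

text \<open>Substitution \<open>y = x + r * z\<close>: the kernel scales by
  \<open>r powr (- 1 - \<alpha>)\<close>, Lebesgue measure by \<open>r\<close>.\<close>

lemma nn_integral_truncated_kernel_diff:
  assumes r: "0 < r"
  shows "(\<integral>\<^sup>+ y. ennreal (truncated_kernel \<alpha> r (x - y)) \<partial>lborel)
    = ennreal (r powr (- \<alpha>)) * (\<integral>\<^sup>+ z. ennreal (truncated_kernel \<alpha> 1 z) \<partial>lborel)"
proof -
  have "truncated_kernel \<alpha> r (r * z) = r powr (- 1 - \<alpha>) * truncated_kernel \<alpha> 1 z" for z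
  proof -
    have "\<bar>r * z\<bar> powr (1 + \<alpha>) = r powr (1 + \<alpha>) * \<bar>z\<bar> powr (1 + \<alpha>)"
      using r by (simp add: abs_mult powr_mult)
    moreover have "r powr (- 1 - \<alpha>) = 1 / r powr (1 + \<alpha>)"
      using powr_minus_divide[of r "1 + \<alpha>"] by simp
    ultimately show ?thesis using r by (simp add: truncated_kernel_def)
  qed
  note scale = this
  have "(\<integral>\<^sup>+ y. ennreal (truncated_kernel \<alpha> r (x - y)) \<partial>lborel)
    = ennreal r * (\<integral>\<^sup>+ z. ennreal (truncated_kernel \<alpha> r (- (r * z))) \<partial>lborel)"
    using r by (subst nn_integral_real_affine[where c = r and t = x]) auto
  also have "\<dots> = ennreal r * (\<integral>\<^sup>+ z. ennreal (r powr (- 1 - \<alpha>)) * ennreal (truncated_kernel \<alpha> 1 z) \<partial>lborel)"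
    by (simp add: truncated_kernel_minus scale ennreal_mult')
  also have "\<dots> = ennreal r * (ennreal (r powr (- 1 - \<alpha>)) * (\<integral>\<^sup>+ z. ennreal (truncated_kernel \<alpha> 1 z) \<partial>lborel))"
    by (subst nn_integral_cmult) auto
  also have "\<dots> = ennreal (r * r powr (- 1 - \<alpha>)) * (\<integral>\<^sup>+ z. ennreal (truncated_kernel \<alpha> 1 z) \<partial>lborel)"
    using r by (simp add: ennreal_mult mult.assoc)
  also have "r * r powr (- 1 - \<alpha>) = r powr (- \<alpha>)"
    using r powr_add[of r 1 "- 1 - \<alpha>"] by simp
  finally show ?thesis .
qed

section \<open>Energy of the ramp\<close>

definition ramp :: "real \<Rightarrow> real \<Rightarrow> real" where
  "ramp r y = min 1 (max 0 (2 * \<bar>y\<bar> / r - 1))"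

lemma measurable_ramp [measurable]: "ramp r \<in> borel_measurable borel"
  unfolding ramp_def[abs_def] by measurable

lemma ramp_bounds: "0 \<le> ramp r y" "ramp r y \<le> 1"
  by (auto simp: ramp_def)

lemma energy_ramp_le:
  assumes r: "0 < r"
  shows "energy \<alpha> (ramp r)
    \<le> ennreal (4 * r powr (1 - \<alpha>)) * (\<integral>\<^sup>+ z. ennreal (truncated_kernel \<alpha> 1 z) \<partial>lborel)"
proof -
  let ?k = "truncated_kernel \<alpha> r" and ?Q = "(\<integral>\<^sup>+ z. ennreal (truncated_kernel \<alpha> 1 z) \<partial>lborel)"
  have diff: "(ramp r x - ramp r y)\<^sup>2 \<le> min 1 (4 * ((x - y) / r)\<^sup>2)" for x y
  proof -
    have "\<bar>ramp r x - ramp r y\<bar> \<le> 1" using ramp_bounds[of r x] ramp_bounds[of r y] by linarith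
    then have "(ramp r x - ramp r y)\<^sup>2 \<le> 1\<^sup>2"
      by (intro abs_le_square_iff[THEN iffD1]) auto
    moreover have "\<bar>ramp r x - ramp r y\<bar> \<le> \<bar>2 * \<bar>x\<bar> / r - 2 * \<bar>y\<bar> / r\<bar>"
    proof -
      have "\<bar>min 1 (max 0 (a - 1)) - min 1 (max 0 (b - 1))\<bar> \<le> \<bar>a - b\<bar>" for a b :: real
        by (simp add: min_def max_def)
      then show ?thesis unfolding ramp_def .
    qed
    moreover have "\<bar>2 * \<bar>x\<bar> / r - 2 * \<bar>y\<bar> / r\<bar> \<le> \<bar>2 * ((x - y) / r)\<bar>"
      using r abs_triangle_ineq3[of x y] by (simp add: abs_divide diff_divide_distrib[symmetric] divide_right_mono)
    ultimately have "(ramp r x - ramp r y)\<^sup>2 \<le> (2 * ((x - y) / r))\<^sup>2"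
      by (intro abs_le_square_iff[THEN iffD1]) linarith
    also have "\<dots> = 4 * ((x - y) / r)\<^sup>2" by (simp only: power_mult_distrib) simp
    finally show ?thesis using \<open>(ramp r x - ramp r y)\<^sup>2 \<le> 1\<^sup>2\<close> by simp
  qed
  have one: "ramp r x = 1" if "x \<notin> {-r..r}" for x
    using that r by (auto simp: ramp_def field_simps min_def max_def)
  \<comment> \<open>Outside \<open>{-r..r}\<close> the ramp is constant, so a nonzero increment
    needs one of the points inside; both choices are added.\<close>
  have pt: "ennreal ((ramp r x - ramp r y)\<^sup>2 / \<bar>x - y\<bar> powr (1 + \<alpha>))
     \<le> indicator {-r..r} x * ennreal (?k (x - y)) + indicator {-r..r} y * ennreal (?k (y - x))" for x y
  proof (cases "x \<in> {-r..r} \<or> y \<in> {-r..r}")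
    case True
    have "(ramp r x - ramp r y)\<^sup>2 / \<bar>x - y\<bar> powr (1 + \<alpha>) \<le> ?k (x - y)"
      unfolding truncated_kernel_def by (intro divide_right_mono diff) auto
    then have "ennreal ((ramp r x - ramp r y)\<^sup>2 / \<bar>x - y\<bar> powr (1 + \<alpha>)) \<le> ennreal (?k (x - y))"
      by (rule ennreal_leI)
    moreover have "?k (y - x) = ?k (x - y)" using truncated_kernel_minus[of \<alpha> r "x - y"] by simp
    ultimately show ?thesis using True
      by (auto split: split_indicator intro: add_increasing add_increasing2)
  qed (simp add: one)
  have "energy \<alpha> (ramp r) \<le> (\<integral>\<^sup>+ x. \<integral>\<^sup>+ y. indicator {-r..r} x * ennreal (?k (x - y))
      + indicator {-r..r} y * ennreal (?k (y - x)) \<partial>lborel \<partial>lborel)"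
    unfolding energy_def local_energy_def by (intro nn_integral_mono pt)
  also have "\<dots> = (\<integral>\<^sup>+ x. \<integral>\<^sup>+ y. indicator {-r..r} x * ennreal (?k (x - y)) \<partial>lborel \<partial>lborel)
      + (\<integral>\<^sup>+ x. \<integral>\<^sup>+ y. indicator {-r..r} y * ennreal (?k (y - x)) \<partial>lborel \<partial>lborel)"
    by (simp add: nn_integral_add)
  \<comment> \<open>Exchanging the variables shows that the two terms agree; each is
    \<open>2 * r powr (1 - \<alpha>)\<close> times the kernel integral.\<close>
  also have "(\<integral>\<^sup>+ x. \<integral>\<^sup>+ y. indicator {-r..r} y * ennreal (?k (y - x)) \<partial>lborel \<partial>lborel)
    = (\<integral>\<^sup>+ x. \<integral>\<^sup>+ y. indicator {-r..r} x * ennreal (?k (x - y)) \<partial>lborel \<partial>lborel)"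
    by (rule lborel_pair.Fubini') measurable
  also have "(\<integral>\<^sup>+ x. \<integral>\<^sup>+ y. indicator {-r..r} x * ennreal (?k (x - y)) \<partial>lborel \<partial>lborel)
    = (\<integral>\<^sup>+ x. (ennreal (r powr (- \<alpha>)) * ?Q) * indicator {-r..r} x \<partial>lborel)"
    by (intro nn_integral_cong) (simp add: nn_integral_cmult nn_integral_truncated_kernel_diff[OF r] mult.commute)
  also have "\<dots> = (ennreal (r powr (- \<alpha>)) * ?Q) * ennreal (2 * r)"
    using r by (subst nn_integral_cmult_indicator) auto
  also have "\<dots> + \<dots> = ennreal (4 * r powr (1 - \<alpha>)) * ?Q"
  proof -
    have "ennreal (4 * r powr (1 - \<alpha>)) = ennreal (r powr (- \<alpha>)) * ennreal (2 * r) + ennreal (r powr (- \<alpha>)) * ennreal (2 * r)"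
      using r powr_add[of r 1 "- \<alpha>"] by (simp flip: ennreal_mult ennreal_plus)
    then show ?thesis by (simp add: distrib_left distrib_right mult_ac)
  qed
  finally show ?thesis .
qed

text \<open>Variational formula, tested with \<open>ln (1 / (2 * prob B))\<close> on
  \<open>B\<close>, 0 on the rest of \<open>A\<close> and minus infinity off \<open>A\<close>, where
  \<open>h\<close> vanishes. The exponential of this function has integral at most
  \<open>1 / 2 + 1 / 4\<close>.\<close>

lemma (in prob_space) Ent_ge:
  assumes h[measurable]: "h \<in> borel_measurable M" and h01: "\<And>x. 0 \<le> h x" "\<And>x. h x \<le> 1"
    and A[measurable]: "A \<in> sets M" and B[measurable]: "B \<in> sets M" and "B \<subseteq> A"
    and hB: "\<And>x. x \<in> B \<Longrightarrow> h x = 1" and hA: "\<And>x. x \<in> space M - A \<Longrightarrow> h x = 0"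
    and mA: "prob A \<le> 1 / 4" and mB: "0 < prob B"
  shows "ereal (prob B * ln (1 / (2 * prob B))) \<le> Ent M h"
proof -
  define b where "b = prob B"
  define p where "p = integral\<^sup>L M h"
  have ih: "integrable M h" by (rule integrable_const_bound[where B = 1]) (use h01 in auto)
  have L: "h x - 1 \<le> h x * ln (h x)" "h x * ln (h x) \<le> 0" for x
    using h01[of x] diff_one_le_mult_ln[of "h x"]
    by (cases "h x = 0"; auto intro: mult_nonneg_nonpos)+
  have iL: "integrable M (\<lambda>x. h x * ln (h x))"
  proof (rule integrable_const_bound[where B = 1])
    show "AE x in M. norm (h x * ln (h x)) \<le> 1"
      using L h01 by (intro AE_I2) (smt (verit) real_norm_def)
  qed measurable
  have iB: "integrable M (indicator B :: _ \<Rightarrow> real)" and iA: "integrable M (indicator A :: _ \<Rightarrow> real)"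
    by (auto intro!: integrable_const_bound[where B = 1])
  have "b = (\<integral>x. indicator B x \<partial>M)" by (simp add: b_def)
  also have "\<dots> \<le> p" unfolding p_def
    using ih iB hB h01 by (intro integral_mono) (auto split: split_indicator)
  finally have p: "0 < p" using mB by (simp add: b_def)
  have b: "0 < b" using mB by (simp add: b_def)
  \<comment> \<open>The resulting Young minorant of \<open>h * ln h\<close>; subtracting
    \<open>p\<close> on all of \<open>A\<close>, including \<open>B\<close>, only lowers it.\<close>
  define v where "v x = h x * ln p + h x + (ln (1 / (2 * b)) - p / (2 * b)) * indicator B x - p * indicator A x" for x
  have "v x \<le> h x * ln (h x)" if x: "x \<in> space M" for x
  proof -
    consider "x \<in> B" | "x \<in> A" "x \<notin> B" | "x \<notin> A" by blast
    then show ?thesis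
    proof cases
      case 1
      have "ln (p / (2 * b)) \<le> p / (2 * b) - 1" using p b by (intro ln_le_minus_one) auto
      then have "ln p + ln (1 / (2 * b)) \<le> p / (2 * b) - 1" using p b by (simp add: ln_div)
      then show ?thesis using 1 hB[OF 1] \<open>B \<subseteq> A\<close> p by (auto simp: v_def)
    next
      case 2
      show ?thesis
      proof (cases "h x = 0")
        case False
        then have hx: "0 < h x" using h01(1)[of x] by simp
        have "h x * ln (p / h x) \<le> h x * (p / h x - 1)"
          using hx p by (intro mult_left_mono ln_le_minus_one) auto
        then have "h x * ln p - h x * ln (h x) \<le> p - h x"
          using hx p by (simp add: ln_div right_diff_distrib)
        then show ?thesis using 2 by (simp add: v_def)
      qed (use 2 p in \<open>simp add: v_def\<close>)
    next
      case 3
      then show ?thesis using \<open>B \<subseteq> A\<close> hA x by (auto simp: v_def indicator_def)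
    qed
  qed
  then have "integral\<^sup>L M v \<le> (\<integral>x. h x * ln (h x) \<partial>M)"
    using ih iL iA iB by (intro integral_mono) (auto simp: v_def[abs_def])
  moreover have "integral\<^sup>L M v = p * ln p + p + (ln (1 / (2 * b)) - p / (2 * b)) * b - p * prob A"
    using ih iA iB unfolding v_def[abs_def] p_def b_def by simp
  moreover have "(ln (1 / (2 * b)) - p / (2 * b)) * b = b * ln (1 / (2 * b)) - p / 2"
    using b by (simp add: left_diff_distrib)
  moreover have "p * prob A \<le> p * (1 / 4)" using mA p by (intro mult_left_mono) auto
  ultimately have "b * ln (1 / (2 * b)) \<le> (\<integral>x. h x * ln (h x) \<partial>M) - p * ln p"
    using p by linarith
  then show ?thesis
    using iL by (simp add: Ent_def ext_integral_eq_integral p_def b_def)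
qed

section \<open>Testing the inequality with the ramp\<close>

lemma mult_ln_inverse_le_one:
  assumes "0 \<le> t"
  shows "t * ln (1 / t) \<le> (1 :: real)"
  using diff_one_le_mult_ln[OF assms] assms by (cases "t = 0") (auto simp: ln_div)

lemma tail_bound_of_log_Sobolev:
  fixes M :: "real measure"
  assumes pr: "prob_space M" and M[measurable_cong]: "sets M = sets borel"
    and \<alpha>: "1 < \<alpha>" "\<alpha> < 2" and D: "0 \<le> D"
    and LS: "\<And>f. \<lbrakk>f \<in> borel_measurable borel; integrable M (\<lambda>x. (f x)\<^sup>2); energy \<alpha> f < \<infinity>\<rbrakk>
      \<Longrightarrow> Ent M (\<lambda>x. (f x)\<^sup>2) \<le> ereal D * enn2ereal (energy \<alpha> f)"
  obtains K where "\<And>r. 0 \<le> r \<Longrightarrow> r powr (\<alpha> - 1) * measure M (- {-r<..<r}) * ln (1 / measure M (- {-r<..<r})) \<le> K"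
proof -
  interpret prob_space M by fact
  define m where "m r = measure M (- {-r<..<r :: real})" for r
  obtain R where R: "1 \<le> R" "m R < 1 / 4"
    using exists_small_tail[OF pr M, of "1/4"] unfolding m_def by auto
  define Q where "Q = enn2real (\<integral>\<^sup>+ z. ennreal (truncated_kernel \<alpha> 1 z) \<partial>lborel)"
  have Q: "(\<integral>\<^sup>+ z. ennreal (truncated_kernel \<alpha> 1 z) \<partial>lborel) = ennreal Q" "0 \<le> Q"
    using nn_integral_truncated_kernel_finite[of \<alpha>] \<alpha> by (auto simp: Q_def)
  \<comment> \<open>The first term covers \<open>r \<le> 2 * R\<close>, where
    \<open>t * ln (1 / t) \<le> 1\<close> suffices. The 8 is the 4 of \<open>energy_ramp_le\<close>,
    doubled when \<open>ln (1 / (2 * m r))\<close> is compared with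
    \<open>ln (1 / m r)\<close>.\<close>
  define K where "K = (2 * R) powr (\<alpha> - 1) + 8 * D * Q"
  show thesis
  proof (rule that[of K], fold m_def)
    fix r :: real assume r0: "0 \<le> r"
    show "r powr (\<alpha> - 1) * m r * ln (1 / m r) \<le> K"
    proof (cases "r \<le> 2 * R \<or> m r = 0")
      case True
      then show ?thesis
      proof
        assume "r \<le> 2 * R"
        have "r powr (\<alpha> - 1) * (m r * ln (1 / m r)) \<le> r powr (\<alpha> - 1) * 1"
          by (intro mult_left_mono mult_ln_inverse_le_one) (auto simp: m_def)
        also have "\<dots> \<le> (2 * R) powr (\<alpha> - 1)"
          using r0 \<alpha> \<open>r \<le> 2 * R\<close> by (simp add: powr_mono2)
        finally show ?thesis using D Q by (simp add: K_def mult.assoc add_increasing2)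
      qed (use D Q in \<open>simp add: K_def\<close>)
    next
      case False
      then have r: "2 * R < r" "0 < r" and mr: "0 < m r"
        using R by (auto simp: m_def zero_less_measure_iff)
      \<comment> \<open>Since \<open>r / 2 > R\<close>, the set where the ramp is nonzero has mass
        below \<open>1 / 4\<close>, as \<open>Ent_ge\<close> requires.\<close>
      have m2: "m (r / 2) \<le> m R" unfolding m_def using r by (intro finite_measure_mono) auto
      have mle: "m r \<le> m (r / 2)" unfolding m_def using r by (intro finite_measure_mono) auto
      define f where "f = ramp r"
      have f01: "0 \<le> (f x)\<^sup>2" "(f x)\<^sup>2 \<le> 1" for x
        using ramp_bounds[of r x] by (auto simp: f_def power_le_one)
      have en: "energy \<alpha> f \<le> ennreal (4 * r powr (1 - \<alpha>) * Q)"
        using energy_ramp_le[OF r(2), of \<alpha>] unfolding f_def Q(1) by (simp add: ennreal_mult')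
      have "ereal (m r * ln (1 / (2 * m r))) \<le> Ent M (\<lambda>x. (f x)\<^sup>2)"
        unfolding m_def
      proof (rule Ent_ge[where A = "- {-(r/2)<..<r/2}"])
        show "- {-r<..<r} \<subseteq> - {-(r/2)<..<r/2}" using r by auto
        show "(f x)\<^sup>2 = 1" if "x \<in> - {-r<..<r}" for x
        proof -
          have "r \<le> \<bar>x\<bar>" using that by auto
          then have "1 \<le> 2 * \<bar>x\<bar> / r - 1" using r by (simp add: field_simps)
          then show ?thesis by (simp add: f_def ramp_def)
        qed
        show "(f x)\<^sup>2 = 0" if "x \<in> space M - (- {-(r/2)<..<r/2})" for x
        proof -
          have "\<bar>x\<bar> \<le> r / 2" using that by auto
          then have "2 * \<bar>x\<bar> / r - 1 \<le> 0" using r by (simp add: field_simps)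
          then show ?thesis by (simp add: f_def ramp_def)
        qed
      qed (use f01 m2 mr R in \<open>auto simp: f_def m_def\<close>)
      also have "\<dots> \<le> ereal D * enn2ereal (energy \<alpha> f)"
      proof (rule LS)
        show "integrable M (\<lambda>x. (f x)\<^sup>2)"
          by (rule integrable_const_bound[where B = 1]) (use f01 in \<open>auto simp: f_def\<close>)
        show "energy \<alpha> f < \<infinity>" using en by (rule le_less_trans) simp
      qed (simp add: f_def)
      also have "\<dots> \<le> ereal D * ereal (4 * r powr (1 - \<alpha>) * Q)"
        using en D Q by (intro ereal_mult_left_mono) (auto simp: less_eq_ennreal.rep_eq enn2ereal_ennreal)
      finally have 1: "m r * ln (1 / (2 * m r)) \<le> D * (4 * r powr (1 - \<alpha>) * Q)" by simp
      \<comment> \<open>Equivalent to \<open>m r \<le> 1 / 4\<close>.\<close>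
      have "ln (1 / m r) \<le> 2 * ln (1 / (2 * m r))"
      proof -
        have "1 / m r \<le> (1 / (2 * m r))\<^sup>2"
          using mr mle m2 R by (simp add: field_simps power2_eq_square)
        then have "ln (1 / m r) \<le> ln ((1 / (2 * m r))\<^sup>2)" using mr by (intro ln_mono) auto
        also have "\<dots> = 2 * ln (1 / (2 * m r))" using mr by (subst ln_realpow) auto
        finally show ?thesis .
      qed
      then have "m r * ln (1 / m r) \<le> m r * (2 * ln (1 / (2 * m r)))"
        using mr by (intro mult_left_mono) auto
      also have "\<dots> \<le> 8 * D * Q * r powr (1 - \<alpha>)" using 1 by (simp add: mult_ac)
      finally have "r powr (\<alpha> - 1) * (m r * ln (1 / m r)) \<le> r powr (\<alpha> - 1) * (8 * D * Q * r powr (1 - \<alpha>))"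
        by (intro mult_left_mono) auto
      also have "\<dots> = 8 * D * Q * (r powr (\<alpha> - 1) * r powr (1 - \<alpha>))" by simp
      also have "r powr (\<alpha> - 1) * r powr (1 - \<alpha>) = 1" using r by (simp flip: powr_add)
      finally show ?thesis by (simp add: K_def mult.assoc add_increasing)
    qed
  qed
qed

section \<open>The speed measure and the equivalence\<close>

lemma prob_space_speed_measure:
  assumes "continuous_on UNIV a" "\<And>x. 0 < a x" "(\<integral>\<^sup>+ x. ennreal (1 / a x) \<partial>lborel) = 1"
  shows "prob_space (speed_measure a)" "absolutely_continuous lborel (speed_measure a)"
proof -
  have [measurable]: "a \<in> borel_measurable borel"
    using assms(1) by (rule borel_measurable_continuous_onI)
  show "prob_space (speed_measure a)"
    unfolding speed_measure_def
    by (rule prob_spaceI) (use assms(3) in \<open>simp add: emeasure_density\<close>)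
  show "absolutely_continuous lborel (speed_measure a)"
    unfolding speed_measure_def by (rule absolutely_continuousI_density) measurable
qed

theorem theorem1p3:
  fixes \<alpha> :: real and a :: "real \<Rightarrow> real" and \<mu> :: "real measure"
  assumes "1 < \<alpha>" and "\<alpha> < 2"
    and "\<And>x. a x > 0"
    and "continuous_on UNIV a"
    and "(\<integral>\<^sup>+ x. ennreal (1 / a x) \<partial>lborel) = 1"
    and "\<mu> = speed_measure a"
  shows "(\<exists>C::real. C > 0 \<and>
            (\<forall>f \<in> stable_form_domain \<alpha> \<mu>.
               Ent \<mu> (\<lambda>x. (f x)\<^sup>2) \<le> ereal (2 / C) * stable_form \<alpha> f f))
     \<longleftrightarrow> (SUP x::real. ereal (\<bar>x\<bar> powr (\<alpha> - 1) * measure \<mu> (- {- \<bar>x\<bar> <..< \<bar>x\<bar>})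
            * ln (1 / measure \<mu> (- {- \<bar>x\<bar> <..< \<bar>x\<bar>})))) < \<infinity>"
    (is "?LS \<longleftrightarrow> (SUP x. ereal (?T x)) < \<infinity>")
proof -
  have pr: "prob_space \<mu>" and ac: "absolutely_continuous lborel \<mu>"
    using prob_space_speed_measure[of a] assms by auto
  have M[measurable_cong]: "sets \<mu> = sets borel" by (simp add: assms(6) speed_measure_def)
  define c where "c = stable_const \<alpha>"
  have c: "0 < c" unfolding c_def using assms by (intro stable_const_pos) auto
  have form: "stable_form \<alpha> f f = ereal (c / 2) * enn2ereal (energy \<alpha> f)"
    if "f \<in> borel_measurable borel" for f
    unfolding c_def using assms that by (intro stable_form_eq_energy) auto
  have dom: "f \<in> stable_form_domain \<alpha> \<mu> \<longleftrightarrow>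
      f \<in> borel_measurable borel \<and> integrable \<mu> (\<lambda>x. (f x)\<^sup>2) \<and> energy \<alpha> f < \<infinity>" for f
  proof -
    have "f \<in> borel_measurable \<mu> \<longleftrightarrow> f \<in> borel_measurable borel"
      by (rule arg_cong[where f = "\<lambda>S. f \<in> S"]) (rule measurable_cong_sets[OF M refl])
    moreover have "stable_form \<alpha> f f < \<infinity> \<longleftrightarrow> energy \<alpha> f < \<infinity>" if "f \<in> borel_measurable borel"
      unfolding form[OF that] using c
      by (cases "energy \<alpha> f") (auto simp: enn2ereal_ennreal)
    ultimately show ?thesis by (auto simp: stable_form_domain_def)
  qed
  show ?thesis
  proof
    assume ?LS
    then obtain C where C: "0 < C" and LS: "\<And>f. f \<in> stable_form_domain \<alpha> \<mu> \<Longrightarrow>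
       Ent \<mu> (\<lambda>x. (f x)\<^sup>2) \<le> ereal (2 / C) * stable_form \<alpha> f f" by blast
    obtain K where K: "\<And>r. 0 \<le> r \<Longrightarrow> r powr (\<alpha> - 1) * measure \<mu> (- {-r<..<r}) * ln (1 / measure \<mu> (- {-r<..<r})) \<le> K"
    proof (rule tail_bound_of_log_Sobolev[OF pr M assms(1,2), of "c / C"])
      \<comment> \<open>The form is \<open>c / 2\<close> times the energy, and
        \<open>2 / C * (c / 2) = c / C\<close>.\<close>
      show "Ent \<mu> (\<lambda>x. (f x)\<^sup>2) \<le> ereal (c / C) * enn2ereal (energy \<alpha> f)"
        if "f \<in> borel_measurable borel" "integrable \<mu> (\<lambda>x. (f x)\<^sup>2)" "energy \<alpha> f < \<infinity>" for f
        using LS[of f] that C by (simp add: dom form mult.assoc[symmetric])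
    qed (use c C in auto)
    have "(SUP x. ereal (?T x)) \<le> ereal K"
      by (rule SUP_least) (use K in simp)
    then show "(SUP x. ereal (?T x)) < \<infinity>" by (rule le_less_trans) simp
  next
    assume fin: "(SUP x. ereal (?T x)) < \<infinity>"
    obtain K where K: "(SUP x. ereal (?T x)) \<le> ereal K"
      using fin by (cases "SUP x. ereal (?T x)") auto
    have K: "r powr (\<alpha> - 1) * measure \<mu> (- {-r<..<r}) * ln (1 / measure \<mu> (- {-r<..<r})) \<le> K"
      if "0 \<le> r" for r
      using order_trans[OF SUP_upper[of r UNIV "\<lambda>x. ereal (?T x)"] K] that by simp
    obtain K' where K': "0 < K'" "\<And>\<rho> x A. \<lbrakk>0 \<le> \<rho>; \<bar>x\<bar> \<le> 1; A \<in> sets \<mu>; \<And>y. y \<in> A \<Longrightarrow> \<rho> \<le> \<bar>y - x\<bar>\<rbrakk>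
       \<Longrightarrow> \<rho> powr (\<alpha> - 1) * ent_profile (measure \<mu> A) \<le> K'"
      by (rule tail_ent_profile_bound[OF pr M assms(1) K]) blast+
    define T where "T = 440 * K' * morrey_const \<alpha>"
    have T: "0 < T" using K'(1) morrey_const_pos[OF assms(1)] by (simp add: T_def)
    \<comment> \<open>The witness \<open>c / T\<close> solves \<open>2 / C * (c / 2) = T\<close> for
      \<open>C\<close>.\<close>
    show ?LS
    proof (intro exI[of _ "c / T"] conjI ballI)
      show "0 < c / T" using c T by simp
      fix f assume "f \<in> stable_form_domain \<alpha> \<mu>"
      then have f: "f \<in> borel_measurable borel" "integrable \<mu> (\<lambda>x. (f x)\<^sup>2)" "energy \<alpha> f < \<infinity>"
        by (auto simp: dom)
      have "Ent \<mu> (\<lambda>x. (f x)\<^sup>2) \<le> ereal T * enn2ereal (energy \<alpha> f)"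
        unfolding T_def by (rule log_Sobolev_of_profile_bound[OF pr M ac assms(1) K'(1) K'(2) f])
      also have "\<dots> = ereal (2 / (c / T)) * stable_form \<alpha> f f"
        using c by (simp add: form[OF f(1)] mult.assoc[symmetric])
      finally show "Ent \<mu> (\<lambda>x. (f x)\<^sup>2) \<le> ereal (2 / (c / T)) * stable_form \<alpha> f f" .
    qed
  qed
qed

end
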